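(* Let $(a,\lambda,k)\in\mathbb R\times\sigma_D\times\mathbb Z_N$, let $\phi=\varphi'(1,\lambda)$, and let $\mathcal H_k^a(\lambda)=\{\psi\in\mathfrak D(H_k^a):H_k^a\psi=\lambda\psi\}$. (i) Every eigenfunction in $\mathcal H_k^a(\lambda)$ vanishes at all vertices of $\Gamma^1$. (ii) There exist $\psi^{(0,\nu)}=(\psi^{(0,\nu)}_{n,j})\in\mathcal H_k^a(\lambda)$, $\nu=1,2$, such that: - $\psi^{(0,\nu)}$ is supported in $\bigcup_{\ell\in\{0,1\}}\bigcup_{j=1}^6\Gamma_{\ell,j}$; - every shift $\psi^{(n,\nu)}$, defined by $\psi^{(n,\nu)}_{m,j}=\psi^{(0,\nu)}_{m-n,j}$, belongs to $\mathcal H_k^a(\lambda)$ for $n\in\mathbb Z$; - every $f\in\mathcal H_k^a(\lambda)$ satisfies $f=\sum_{(n,\nu)\in\mathbb Z\times\{1,2\}}\hat f_{n,\nu}\psi^{(n,\nu)}$ with $(\hat f_{n,1},\hat f_{n,2})_{n\in\mathbb Z}\in\ell^2\oplus\ell^2$. The coefficients are as follows: - If $(s_k,\phi^2)=(0,1)$, then $\hat f_{n,1}=f'_{n,1}(0)$ and $\hat f_{n,2}=f'_{n,2}(0)$. - If $(s_k,\phi^2)\neq(0,1)$, then $\tilde\varkappa_1=1-s^ke^{2ia}\phi^2\ne0$, $\tilde\varkappa_2=1-s^ke^{2ia}\phi^4\neq0$, and $$\hat f_{n,1}=\frac{f'_{n,5}(0)+s^k\phi e^{i(a+a_1)}f'_{n,6}(0)}{\tilde\varkappa_1\tilde\varkappa_2},\qquad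 \hat f_{n,2}=-\frac{e^{ia_1}f'_{n,6}(0)+\phi e^{ia}f'_{n,5}(0)}{\tilde\varkappa_1\tilde\varkappa_2}.$$ The map $f\mapsto(\hat f_{n,1},\hat f_{n,2})_{n\in\mathbb Z}$ is a linear isomorphism between $\mathcal H_k^a(\lambda)$ and $\ell^2\oplus\ell^2$.
   Context: Fix an integer $N\ge1$ and a real potential $q\in L^2(0,1)$. For $\lambda\in\mathbb C$, let $\vartheta(t,\lambda),\varphi(t,\lambda)$ solve $-y''+qy=\lambda y$ with $\vartheta(0)=\varphi'(0)=1$ and $\vartheta'(0)=\varphi(0)=0$. $\sigma_D$ is the Dirichlet spectrum of $-y''+qy=\lambda y$, $y(0)=y(1)=0$. Let $\Gamma^1$ be the graph with edges $\Gamma_{n,j}$, $(n,j)\in\mathbb Z\times\{1,\dots,6\}$, each identified with $[0,1]$, and $L^2(\Gamma^1)=\bigoplus L^2(0,1)$. The edges meet at vertices as encoded by the boundary conditions below: for each $n$, the endpoints $\Gamma_{n,1}(1),\Gamma_{n,2}(0),\Gamma_{n,5}(0)$ form a vertex, as do $\Gamma_{n,2}(1),\Gamma_{n,3}(0),\Gamma_{n,6}(0)$; $\Gamma_{n,3}(1),\Gamma_{n,4}(0),\Gamma_{n-1,6}(1)$; and $\Gamma_{n,4}(1),\Gamma_{n,1}(0),\Gamma_{n-1,5}(1)$. Let $a_1,a_2\in\mathbb R$, $a=a_1+a_2$, $s=e^{2\pi i/N}$, $k\in\mathbb Z_N$, and $s_k=\sin(\pi k/N+a)$. The boundary conditions (BC)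 for a family $f=(f_{n,j})$ are, for all $n\in\mathbb Z$: - $e^{ia_1}f_{n,1}(1)=f_{n,2}(0)=f_{n,5}(0)$; - $e^{ia_2}f_{n,2}(1)=f_{n,3}(0)=f_{n,6}(0)$; - $e^{ia_1}f_{n,3}(1)=f_{n,4}(0)=e^{ia_1}f_{n-1,6}(1)$; - $e^{ia_2}s^kf_{n,4}(1)=f_{n,1}(0)=e^{-ia_1}f_{n-1,5}(1)$; - $e^{ia_1}f'_{n,1}(1)-f'_{n,2}(0)-f'_{n,5}(0)=0$; - $e^{ia_2}f'_{n,2}(1)-f'_{n,3}(0)-f'_{n,6}(0)=0$; - $e^{ia_1}f'_{n,3}(1)-f'_{n,4}(0)+e^{ia_1}f'_{n-1,6}(1)=0$; - $e^{ia_2}s^kf'_{n,4}(1)-f'_{n,1}(0)+e^{-ia_1}f'_{n-1,5}(1)=0$. $H_k^a$ acts in $L^2(\Gamma^1)$ by $(H_k^af)_{n,j}=-f''_{n,j}+qf_{n,j}$ with domain $\mathfrak D(H_k^a)$ consisting of $f$ with $(f_{n,j}),(f''_{n,j})\in L^2(\Gamma^1)$ satisfying (BC). *)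

theory Defs
  imports "HOL-Analysis.Analysis"
begin

definition d01 :: "(real \<Rightarrow> complex) \<Rightarrow> real \<Rightarrow> complex" where
  "d01 y t = vector_derivative y (at t within {0..1})"

text \<open>y2 is a (weak) second derivative of y on [0,1]: y is C^1 on [0,1] with derivative y1,
  and y1 is the indefinite integral of y2 (so y1 is absolutely continuous, y1' = y2 a.e.).\<close>
definition has_d2 :: "(real \<Rightarrow> complex) \<Rightarrow> (real \<Rightarrow> complex) \<Rightarrow> bool" where
  "has_d2 y y2 \<longleftrightarrow> (\<exists>y1. (\<forall>t\<in>{0..1}. (y has_vector_derivative y1 t) (at t within {0..1})) \<and>
                        (\<forall>t\<in>{0..1}. (y2 has_integral (y1 t - y1 0)) {0..t}))"

definition sq_int01 :: "(real \<Rightarrow> complex) \<Rightarrow> bool" where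
  "sq_int01 g \<longleftrightarrow> g measurable_on {0..1} \<and> (\<lambda>t. (cmod (g t))\<^sup>2) integrable_on {0..1}"

definition l2_graph :: "(int \<Rightarrow> nat \<Rightarrow> real \<Rightarrow> complex) \<Rightarrow> bool" where
  "l2_graph g \<longleftrightarrow> (\<forall>n. \<forall>j\<in>{1..6}. sq_int01 (g n j)) \<and>
     ((\<lambda>(n,j). integral {0..1} (\<lambda>t. (cmod (g n j t))\<^sup>2)) summable_on (UNIV \<times> {1..6::nat}))"

definition l2_seq :: "(int \<Rightarrow> complex) \<Rightarrow> bool" where
  "l2_seq c \<longleftrightarrow> (\<lambda>n. (cmod (c n))\<^sup>2) summable_on UNIV"

definition sl_sol :: "(real \<Rightarrow> real) \<Rightarrow> complex \<Rightarrow> (real \<Rightarrow> complex) \<Rightarrow> bool" where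
  "sl_sol q \<mu> y \<longleftrightarrow> has_d2 y (\<lambda>t. (complex_of_real (q t) - \<mu>) * y t)"

definition dir_spec :: "(real \<Rightarrow> real) \<Rightarrow> complex set" where
  "dir_spec q = {\<mu>. \<exists>y. sl_sol q \<mu> y \<and> y 0 = 0 \<and> y 1 = 0 \<and> (\<exists>t\<in>{0..1}. y t \<noteq> 0)}"

definition phi_d1 :: "(real \<Rightarrow> real) \<Rightarrow> complex \<Rightarrow> complex" where
  "phi_d1 q \<mu> = (THE c. \<exists>y. sl_sol q \<mu> y \<and> y 0 = 0 \<and> d01 y 0 = 1 \<and> d01 y 1 = c)"

definition sroot :: "nat \<Rightarrow> complex" where
  "sroot N = cis (2 * pi / real N)"

definition BC :: "real \<Rightarrow> real \<Rightarrow> nat \<Rightarrow> nat \<Rightarrow> (int \<Rightarrow> nat \<Rightarrow> real \<Rightarrow> complex) \<Rightarrow> bool" where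
  "BC a1 a2 N k f \<longleftrightarrow> (\<forall>n::int.
     cis a1 * f n 1 1 = f n 2 0 \<and> f n 2 0 = f n 5 0 \<and>
     cis a2 * f n 2 1 = f n 3 0 \<and> f n 3 0 = f n 6 0 \<and>
     cis a1 * f n 3 1 = f n 4 0 \<and> f n 4 0 = cis a1 * f (n - 1) 6 1 \<and>
     cis a2 * sroot N ^ k * f n 4 1 = f n 1 0 \<and> f n 1 0 = cis (- a1) * f (n - 1) 5 1 \<and>
     cis a1 * d01 (f n 1) 1 - d01 (f n 2) 0 - d01 (f n 5) 0 = 0 \<and>
     cis a2 * d01 (f n 2) 1 - d01 (f n 3) 0 - d01 (f n 6) 0 = 0 \<and>
     cis a1 * d01 (f n 3) 1 - d01 (f n 4) 0 + cis a1 * d01 (f (n - 1) 6) 1 = 0 \<and>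
     cis a2 * sroot N ^ k * d01 (f n 4) 1 - d01 (f n 1) 0 + cis (- a1) * d01 (f (n - 1) 5) 1 = 0)"

definition dom_H :: "real \<Rightarrow> real \<Rightarrow> nat \<Rightarrow> nat \<Rightarrow> (int \<Rightarrow> nat \<Rightarrow> real \<Rightarrow> complex)
    \<Rightarrow> (int \<Rightarrow> nat \<Rightarrow> real \<Rightarrow> complex) \<Rightarrow> bool" where
  "dom_H a1 a2 N k f f2 \<longleftrightarrow> (\<forall>n. \<forall>j\<in>{1..6}. has_d2 (f n j) (f2 n j)) \<and>
      l2_graph f \<and> l2_graph f2 \<and> BC a1 a2 N k f"

definition eig_space :: "(real \<Rightarrow> real) \<Rightarrow> real \<Rightarrow> real \<Rightarrow> nat \<Rightarrow> nat \<Rightarrow> complex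
    \<Rightarrow> (int \<Rightarrow> nat \<Rightarrow> real \<Rightarrow> complex) set" where
  "eig_space q a1 a2 N k \<mu> = {f. \<exists>f2. dom_H a1 a2 N k f f2 \<and>
      (\<forall>n. \<forall>j\<in>{1..6}. negligible {t\<in>{0..1}. - f2 n j t + complex_of_real (q t) * f n j t \<noteq> \<mu> * f n j t})}"

text \<open>Equality of two families as elements of L^2(Gamma^1) (pointwise on the edges; both
  are continuous on each edge, so this is equality in L^2).\<close>
definition graph_eq :: "(int \<Rightarrow> nat \<Rightarrow> real \<Rightarrow> complex) \<Rightarrow> (int \<Rightarrow> nat \<Rightarrow> real \<Rightarrow> complex) \<Rightarrow> bool" where
  "graph_eq f g \<longleftrightarrow> (\<forall>n. \<forall>j\<in>{1..6}. \<forall>t\<in>{0..1}. f n j t = g n j t)"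

definition s_k :: "real \<Rightarrow> real \<Rightarrow> nat \<Rightarrow> nat \<Rightarrow> real" where
  "s_k a1 a2 N k = sin (pi * real k / real N + (a1 + a2))"

definition kappa1 :: "real \<Rightarrow> real \<Rightarrow> nat \<Rightarrow> nat \<Rightarrow> complex \<Rightarrow> complex" where
  "kappa1 a1 a2 N k \<phi> = 1 - sroot N ^ k * cis (2 * (a1 + a2)) * \<phi>\<^sup>2"

definition kappa2 :: "real \<Rightarrow> real \<Rightarrow> nat \<Rightarrow> nat \<Rightarrow> complex \<Rightarrow> complex" where
  "kappa2 a1 a2 N k \<phi> = 1 - sroot N ^ k * cis (2 * (a1 + a2)) * \<phi> ^ 4"

definition hatf :: "real \<Rightarrow> real \<Rightarrow> nat \<Rightarrow> nat \<Rightarrow> complex \<Rightarrow> (int \<Rightarrow> nat \<Rightarrow> real \<Rightarrow> complex)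
    \<Rightarrow> int \<Rightarrow> nat \<Rightarrow> complex" where
  "hatf a1 a2 N k \<phi> f n \<nu> =
     (if s_k a1 a2 N k = 0 \<and> \<phi>\<^sup>2 = 1 then
        (if \<nu> = 1 then d01 (f n 1) 0 else d01 (f n 2) 0)
      else if \<nu> = 1 then
        (d01 (f n 5) 0 + sroot N ^ k * \<phi> * cis (a1 + a2 + a1) * d01 (f n 6) 0)
          / (kappa1 a1 a2 N k \<phi> * kappa2 a1 a2 N k \<phi>)
      else
        - (cis a1 * d01 (f n 6) 0 + \<phi> * cis (a1 + a2) * d01 (f n 5) 0)
          / (kappa1 a1 a2 N k \<phi> * kappa2 a1 a2 N k \<phi>))"

definition shift :: "int \<Rightarrow> (int \<Rightarrow> nat \<Rightarrow> real \<Rightarrow> complex) \<Rightarrow> (int \<Rightarrow> nat \<Rightarrow> real \<Rightarrow> complex)" where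
  "shift n \<psi> = (\<lambda>m j t. \<psi> (m - n) j t)"

end

theory Submission
  imports Defs
begin

text \<open>At a Dirichlet eigenvalue the solution \<open>w\<close> with \<open>w(0) = 0\<close>, \<open>w'(0) = 1\<close> also vanishes at
  \<open>1\<close>. For every solution \<open>g\<close> on an edge the Wronskian with \<open>w\<close> gives \<open>g(1) w'(1) = g(0)\<close> and
  \<open>g(0) = 2 \<integral> g w'\<close>. The first relation and continuity at the vertices make the value at one
  family of vertices independent of the cell, and by the second this value is square summable,
  hence zero. So an eigenfunction is \<open>A n j \<cdot> w\<close> on each edge, and only the Kirchhoff conditions
  remain: a linear recurrence for \<open>A\<close>, whose square-summable solutions are parametrised freely by
  two sequences, each influencing two consecutive cells. In the degenerate case the recurrence
  leaves a cell-independent quantity, which square summability again forces to vanish.\<close>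

section \<open>Primitives of integrable functions\<close>

definition primitive_on :: "real \<Rightarrow> real \<Rightarrow> (real \<Rightarrow> 'a::real_normed_vector) \<Rightarrow> (real \<Rightarrow> 'a) \<Rightarrow> bool"
  where "primitive_on a b g v \<longleftrightarrow> (\<forall>t\<in>{a..b}. (g has_integral (v t - v a)) {a..t})"

lemma primitive_on_integrable:
  assumes "primitive_on a b g v"
  shows "g integrable_on {a..b}"
proof (cases "a \<le> b")
  case True
  then have "(g has_integral (v b - v a)) {a..b}"
    using assms by (simp add: primitive_on_def)
  then show ?thesis by blast
qed auto

lemma primitive_on_increment:
  fixes v :: "real \<Rightarrow> 'a::banach"
  assumes v: "primitive_on a b g v" and st: "a \<le> s" "s \<le> t" "t \<le> b"
  shows "(g has_integral (v t - v s)) {s..t}"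
proof -
  have at: "(g has_integral (v t - v a)) {a..t}" and as: "(g has_integral (v s - v a)) {a..s}"
    using v st by (auto simp: primitive_on_def)
  have "g integrable_on {s..t}"
    using integrable_on_subinterval[of g "{a..t}" s t] at st by (auto simp: has_integral_iff)
  then have st_int: "(g has_integral integral {s..t} g) {s..t}" by (rule integrable_integral)
  have "v s - v a + integral {s..t} g = v t - v a"
    using has_integral_unique[OF has_integral_combine[OF st(1,2) as st_int] at] .
  then have "integral {s..t} g = v t - v s" by (simp add: algebra_simps)
  then show ?thesis using st_int by simp
qed

lemma primitive_on_continuous:
  fixes v :: "real \<Rightarrow> 'a::banach"
  assumes "primitive_on a b g v"
  shows "continuous_on {a..b} v"
proof (rule continuous_on_eq)
  show "continuous_on {a..b} (\<lambda>t. v a + integral {a..t} g)"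
    by (intro continuous_intros indefinite_integral_continuous_1 primitive_on_integrable[OF assms])
  show "v a + integral {a..t} g = v t" if "t \<in> {a..b}" for t
    using assms that by (auto simp: primitive_on_def has_integral_iff)
qed

lemma primitive_on_iff_has_vector_derivative:
  fixes v :: "real \<Rightarrow> 'a::banach"
  assumes g: "continuous_on {a..b} g"
  shows "primitive_on a b g v \<longleftrightarrow> (\<forall>t\<in>{a..b}. (v has_vector_derivative g t) (at t within {a..b}))"
proof (intro iffI ballI)
  fix t assume v: "primitive_on a b g v" and t: "t \<in> {a..b}"
  have "((\<lambda>r. v a + integral {a..r} g) has_vector_derivative 0 + g t) (at t within {a..b})"
    by (intro has_vector_derivative_add has_vector_derivative_const
        integral_has_vector_derivative g t)
  then have "((\<lambda>r. v a + integral {a..r} g) has_vector_derivative g t) (at t within {a..b})"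
    by simp
  then show "(v has_vector_derivative g t) (at t within {a..b})"
    by (rule has_vector_derivative_transform[OF t, rotated])
      (use v in \<open>auto simp: primitive_on_def has_integral_iff\<close>)
next
  assume v: "\<forall>t\<in>{a..b}. (v has_vector_derivative g t) (at t within {a..b})"
  show "primitive_on a b g v"
    unfolding primitive_on_def
  proof (intro ballI fundamental_theorem_of_calculus)
    fix t r assume "t \<in> {a..b}" "r \<in> {a..t}"
    then show "(v has_vector_derivative g r) (at r within {a..t})"
      using v by (intro has_vector_derivative_within_subset[where S="{a..b}" and T="{a..t}"]) auto
  qed auto
qed

lemma primitive_on_bounded_linear:
  assumes "primitive_on a b g v" and h: "bounded_linear h"
  shows "primitive_on a b (\<lambda>t. h (g t)) (\<lambda>t. h (v t))"
  unfolding primitive_on_def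
proof
  fix t assume "t \<in> {a..b}"
  then have "((h \<circ> g) has_integral h (v t - v a)) {a..t}"
    using assms by (intro has_integral_linear) (auto simp: primitive_on_def)
  then show "((\<lambda>t. h (g t)) has_integral (h (v t) - h (v a))) {a..t}"
    by (simp add: o_def linear_diff[OF bounded_linear.linear[OF h]])
qed

lemma primitive_on_add:
  assumes "primitive_on a b g v" "primitive_on a b k w"
  shows "primitive_on a b (\<lambda>t. g t + k t) (\<lambda>t. v t + w t)"
  unfolding primitive_on_def
proof
  fix t assume "t \<in> {a..b}"
  then have "((\<lambda>t. g t + k t) has_integral ((v t - v a) + (w t - w a))) {a..t}"
    using assms by (intro has_integral_add) (auto simp: primitive_on_def)
  then show "((\<lambda>t. g t + k t) has_integral (v t + w t - (v a + w a))) {a..t}"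
    by (simp add: algebra_simps)
qed

lemma primitive_on_cong:
  assumes "primitive_on a b g v"
    and "\<And>t. t \<in> {a..b} \<Longrightarrow> g t = h t" "\<And>t. t \<in> {a..b} \<Longrightarrow> v t = w t"
  shows "primitive_on a b h w"
  unfolding primitive_on_def
proof
  fix t assume t: "t \<in> {a..b}"
  then have "(h has_integral (v t - v a)) {a..t}"
    using assms(1,2) by (intro has_integral_eq[of "{a..t}" g h]) (auto simp: primitive_on_def)
  then show "(h has_integral (w t - w a)) {a..t}" using assms(3) t by simp
qed

lemma absolutely_integrable_mult_continuous:
  fixes g y :: "real \<Rightarrow> 'a::{euclidean_space,real_normed_field}"
  assumes g: "g absolutely_integrable_on {a..b}" and y: "continuous_on {a..b} y"
  shows "(\<lambda>s. g s * y s) absolutely_integrable_on {a..b}"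
proof -
  have "(\<lambda>s. y s * g s) absolutely_integrable_on {a..b}"
  proof (rule absolutely_integrable_bounded_measurable_product[OF bilinear_times])
    show "y \<in> borel_measurable (lebesgue_on {a..b})"
      by (rule continuous_imp_measurable_on_sets_lebesgue[OF y]) auto
    show "bounded (y ` {a..b})" by (intro compact_imp_bounded compact_continuous_image y) auto
  qed (use g in auto)
  then show ?thesis by (simp add: mult.commute)
qed

lemma primitive_on_oscillation:
  fixes v :: "real \<Rightarrow> 'a::banach"
  assumes v: "primitive_on a b g v" and g: "(\<lambda>s. norm (g s)) integrable_on {a..b}"
    and "a \<le> s" "s \<le> x" "x \<le> y" "y \<le> t" "t \<le> b"
  shows "norm (v y - v x) \<le> integral {s..t} (\<lambda>r. norm (g r))"
proof -
  have sub: "(\<lambda>s. norm (g s)) integrable_on {x..y}" "(\<lambda>s. norm (g s)) integrable_on {s..t}"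
    using assms by (auto intro: integrable_on_subinterval)
  have "norm (v y - v x) = norm (integral {x..y} g)"
    using primitive_on_increment[OF v, of x y] assms by (simp add: integral_unique)
  also have "\<dots> \<le> integral {x..y} (\<lambda>r. norm (g r))"
    using primitive_on_increment[OF v, of x y] assms sub
    by (intro integral_norm_bound_integral) auto
  also have "\<dots> \<le> integral {s..t} (\<lambda>r. norm (g r))"
    using assms sub by (intro integral_subset_le) auto
  finally show ?thesis .
qed

lemma has_integral_norm_le:
  fixes f :: "real \<Rightarrow> 'a::banach"
  assumes "(f has_integral I) S" "(g has_integral B) S" "\<And>x. x \<in> S \<Longrightarrow> norm (f x) \<le> g x"
  shows "norm I \<le> B"
  using integral_norm_bound_integral[of f S g] assms by (auto simp: has_integral_iff)

lemma integral_small_on_short_intervals: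
  fixes k :: "real \<Rightarrow> 'a::banach"
  assumes k: "k integrable_on {a..b}" and "\<epsilon> > 0"
  obtains \<delta> where "\<delta> > 0"
    "\<And>s t. a \<le> s \<Longrightarrow> s \<le> t \<Longrightarrow> t \<le> b \<Longrightarrow> t - s < \<delta> \<Longrightarrow> norm (integral {s..t} k) < \<epsilon>"
proof -
  have "uniformly_continuous_on {a..b} (\<lambda>t. integral {a..t} k)"
    by (intro compact_uniformly_continuous indefinite_integral_continuous_1 k) auto
  then obtain \<delta> where "\<delta> > 0" and \<delta>: "\<And>s t. s \<in> {a..b} \<Longrightarrow> t \<in> {a..b} \<Longrightarrow> dist t s < \<delta> \<Longrightarrow>
      dist (integral {a..t} k) (integral {a..s} k) < \<epsilon>"
    using \<open>\<epsilon> > 0\<close> by (rule uniformly_continuous_onE) blast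
  show ?thesis
  proof (rule that[OF \<open>\<delta> > 0\<close>])
    fix s t assume st: "a \<le> s" "s \<le> t" "t \<le> b" "t - s < \<delta>"
    have "integral {a..s} k + integral {s..t} k = integral {a..t} k"
      using st by (intro Henstock_Kurzweil_Integration.integral_combine
          integrable_on_subinterval[OF k]) auto
    then have "integral {a..t} k - integral {a..s} k = integral {s..t} k"
      by (simp add: algebra_simps)
    then show "norm (integral {s..t} k) < \<epsilon>"
      using \<delta>[of s t] st by (simp add: dist_norm)
  qed
qed

lemma norm_increment_le_integral_if_short:
  fixes F :: "real \<Rightarrow> 'a::real_normed_vector" and q :: "real \<Rightarrow> real"
  assumes "a \<le> b" and q: "q integrable_on {a..b}" and "\<delta> > 0"
    and short: "\<And>s t. a \<le> s \<Longrightarrow> s \<le> t \<Longrightarrow> t \<le> b \<Longrightarrow> t - s < \<delta> \<Longrightarrow>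
      norm (F t - F s) \<le> integral {s..t} q"
  shows "norm (F b - F a) \<le> integral {a..b} q"
proof -
  define P where "P = (\<lambda>s t. a \<le> s \<and> t \<le> b \<longrightarrow> norm (F t - F s) \<le> integral {s..t} q)"
  from \<open>a \<le> b\<close> have "P a b"
  proof (induction rule: Bolzano)
    case (trans r s t)
    show "P r t"
      unfolding P_def
    proof
      assume rt: "a \<le> r \<and> t \<le> b"
      have "norm (F t - F r) \<le> norm (F t - F s) + norm (F s - F r)"
        using norm_triangle_ineq[of "F t - F s" "F s - F r"] by simp
      also have "\<dots> \<le> integral {s..t} q + integral {r..s} q"
        using trans rt by (intro add_mono) (auto simp: P_def)
      also have "\<dots> = integral {r..t} q"
        using trans(3,4) rt Henstock_Kurzweil_Integration.integral_combine[of r s t q]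
          integrable_on_subinterval[OF q, of r t] by simp
      finally show "norm (F t - F r) \<le> integral {r..t} q" .
    qed
  next
    case (local x)
    have "P s t" if "s \<le> x" "x \<le> t" "t - s < \<delta>" for s t
      using short[of s t] that by (simp add: P_def)
    then show ?case using \<open>\<delta> > 0\<close> by blast
  qed
  then show ?thesis by (simp add: P_def)
qed

lemma increments_le_integral_product_imp_eq:
  fixes F :: "real \<Rightarrow> 'a::real_normed_vector" and p q :: "real \<Rightarrow> real"
  assumes "a \<le> b" and p: "p integrable_on {a..b}" and q: "q integrable_on {a..b}"
    and q_nonneg: "\<And>t. t \<in> {a..b} \<Longrightarrow> 0 \<le> q t"
    and increment: "\<And>s t. a \<le> s \<Longrightarrow> s \<le> t \<Longrightarrow> t \<le> b \<Longrightarrow>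
      norm (F t - F s) \<le> integral {s..t} p * integral {s..t} q"
  shows "F b = F a"
proof -
  have bound: "norm (F b - F a) \<le> \<epsilon> * integral {a..b} q" if "\<epsilon> > 0" for \<epsilon>
  proof -
    obtain \<delta> where "\<delta> > 0" and \<delta>: "\<And>s t. a \<le> s \<Longrightarrow> s \<le> t \<Longrightarrow> t \<le> b \<Longrightarrow> t - s < \<delta> \<Longrightarrow>
        norm (integral {s..t} p) < \<epsilon>"
      using integral_small_on_short_intervals[OF p \<open>\<epsilon> > 0\<close>] by blast
    have "norm (F t - F s) \<le> integral {s..t} (\<lambda>r. \<epsilon> * q r)"
      if "a \<le> s" "s \<le> t" "t \<le> b" "t - s < \<delta>" for s t
    proof -
      have "norm (F t - F s) \<le> integral {s..t} p * integral {s..t} q"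
        using increment that by simp
      also have "\<dots> \<le> \<epsilon> * integral {s..t} q"
        using \<delta>[of s t] q_nonneg that
        by (intro mult_right_mono Henstock_Kurzweil_Integration.integral_nonneg
            integrable_on_subinterval[OF q]) auto
      finally show ?thesis by simp
    qed
    with \<open>a \<le> b\<close> integrable_on_mult_right[OF q] \<open>\<delta> > 0\<close>
    have "norm (F b - F a) \<le> integral {a..b} (\<lambda>r. \<epsilon> * q r)"
      by (rule norm_increment_le_integral_if_short)
    then show ?thesis by simp
  qed
  have "((\<lambda>\<epsilon>. \<epsilon> * integral {a..b} q) \<longlongrightarrow> 0 * integral {a..b} q) (at_right 0)"
    by (intro tendsto_intros)
  then have "norm (F b - F a) \<le> 0"
    using bound by (intro tendsto_lowerbound[where F = "at_right 0"])
      (auto simp: eventually_at_filter)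
  then show ?thesis by simp
qed

lemma primitive_on_mult_integrable:
  fixes u v u' v' :: "real \<Rightarrow> 'a::{euclidean_space,real_normed_field}"
  assumes u: "primitive_on a b u' u" "u' absolutely_integrable_on {a..b}"
    and v: "primitive_on a b v' v" "v' absolutely_integrable_on {a..b}"
  shows "(\<lambda>t. u' t * v t + u t * v' t) integrable_on {a..b}"
proof -
  have "(\<lambda>t. u' t * v t) absolutely_integrable_on {a..b}"
       "(\<lambda>t. v' t * u t) absolutely_integrable_on {a..b}"
    using u v by (auto intro: absolutely_integrable_mult_continuous primitive_on_continuous)
  then show ?thesis
    unfolding absolutely_integrable_on_def by (auto intro: integrable_add simp: mult.commute)
qed

text \<open>The product rule on \<open>[s, t]\<close> fails at most by the integral of
  \<open>u'(r) (v(r) - v(t)) + (u(r) - u(s)) v'(r)\<close>.\<close>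

lemma primitive_on_mult_defect_le:
  fixes u v u' v' :: "real \<Rightarrow> 'a::{euclidean_space,real_normed_field}"
  assumes u: "primitive_on a b u' u" "u' absolutely_integrable_on {a..b}"
    and v: "primitive_on a b v' v" "v' absolutely_integrable_on {a..b}"
    and st: "a \<le> s" "s \<le> t" "t \<le> b"
  shows "norm (integral {s..t} (\<lambda>r. u' r * v r + u r * v' r) - (u t * v t - u s * v s))
    \<le> 2 * integral {s..t} (\<lambda>r. norm (u' r)) * integral {s..t} (\<lambda>r. norm (v' r))"
proof -
  let ?p = "\<lambda>r. norm (u' r)" and ?q = "\<lambda>r. norm (v' r)"
  define h where "h = (\<lambda>r. u' r * v r + u r * v' r)"
  have norms: "?p integrable_on {a..b}" "?q integrable_on {a..b}"
    using u v by (auto simp: absolutely_integrable_on_def)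
  have "h integrable_on {a..b}" unfolding h_def by (rule primitive_on_mult_integrable[OF u v])
  with norms have sub: "h integrable_on {s..t}" "?p integrable_on {s..t}" "?q integrable_on {s..t}"
    using st by (auto intro: integrable_on_subinterval)
  have "((\<lambda>r. h r - u' r * v t - u s * v' r) has_integral
      (integral {s..t} h - (u t - u s) * v t - u s * (v t - v s))) {s..t}"
    by (intro has_integral_diff has_integral_mult_left has_integral_mult_right
        integrable_integral sub primitive_on_increment[OF u(1) st]
        primitive_on_increment[OF v(1) st])
  moreover have "((\<lambda>r. ?p r * integral {s..t} ?q + integral {s..t} ?p * ?q r) has_integral
      integral {s..t} ?p * integral {s..t} ?q + integral {s..t} ?p * integral {s..t} ?q) {s..t}"
    by (intro has_integral_add has_integral_mult_left has_integral_mult_right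
        integrable_integral sub)
  moreover have "norm (h r - u' r * v t - u s * v' r)
      \<le> ?p r * integral {s..t} ?q + integral {s..t} ?p * ?q r" if r: "r \<in> {s..t}" for r
  proof -
    have "h r - u' r * v t - u s * v' r = (u r - u s) * v' r - u' r * (v t - v r)"
      by (simp add: h_def algebra_simps)
    also have "norm \<dots> \<le> norm (u r - u s) * ?q r + ?p r * norm (v t - v r)"
      by (rule norm_triangle_ineq4[THEN order_trans]) (simp add: norm_mult)
    also have "\<dots> \<le> integral {s..t} ?p * ?q r + ?p r * integral {s..t} ?q"
      using st r by (intro add_mono mult_left_mono mult_right_mono
          primitive_on_oscillation[OF u(1)] primitive_on_oscillation[OF v(1)] norms) auto
    finally show ?thesis by simp
  qed
  ultimately have "norm (integral {s..t} h - (u t - u s) * v t - u s * (v t - v s))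
      \<le> integral {s..t} ?p * integral {s..t} ?q + integral {s..t} ?p * integral {s..t} ?q"
    by (rule has_integral_norm_le)
  then show ?thesis by (simp add: h_def algebra_simps)
qed

lemma primitive_on_mult:
  fixes u v u' v' :: "real \<Rightarrow> 'a::{euclidean_space,real_normed_field}"
  assumes u: "primitive_on a b u' u" "u' absolutely_integrable_on {a..b}"
    and v: "primitive_on a b v' v" "v' absolutely_integrable_on {a..b}"
  shows "primitive_on a b (\<lambda>t. u' t * v t + u t * v' t) (\<lambda>t. u t * v t)"
  unfolding primitive_on_def
proof
  fix x assume x: "x \<in> {a..b}"
  define h where "h = (\<lambda>t. u' t * v t + u t * v' t)"
  define F where "F = (\<lambda>t. integral {a..t} h - u t * v t)"
  let ?p = "\<lambda>r. norm (u' r)" and ?q = "\<lambda>r. norm (v' r)"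
  have norms: "?p integrable_on {a..b}" "?q integrable_on {a..b}"
    using u v by (auto simp: absolutely_integrable_on_def)
  have h: "h integrable_on {a..b}" unfolding h_def by (rule primitive_on_mult_integrable[OF u v])
  have "F x = F a"
  proof (rule increments_le_integral_product_imp_eq[where p = "\<lambda>r. 2 * ?p r" and q = ?q])
    fix s t assume st: "a \<le> s" "s \<le> t" "t \<le> x"
    then have "h integrable_on {a..t}"
      using x h by (auto intro: integrable_on_subinterval)
    from Henstock_Kurzweil_Integration.integral_combine[OF st(1,2) this]
    have "F t - F s = integral {s..t} h - (u t * v t - u s * v s)"
      by (simp add: F_def algebra_simps)
    then show "norm (F t - F s) \<le> integral {s..t} (\<lambda>r. 2 * ?p r) * integral {s..t} ?q"
      using primitive_on_mult_defect_le[OF u v, of s t] st x by (simp add: h_def)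
  qed (use x norms in \<open>auto intro: integrable_on_subinterval\<close>)
  then have "integral {a..x} h = u x * v x - u a * v a" by (simp add: F_def algebra_simps)
  moreover have "h integrable_on {a..x}" using h x by (auto intro: integrable_on_subinterval)
  ultimately show "((\<lambda>t. u' t * v t + u t * v' t) has_integral (u x * v x - u a * v a)) {a..x}"
    unfolding h_def by (auto simp: has_integral_iff)
qed

lemma vanishing_on_short_interval:
  fixes Y :: "real \<Rightarrow> 'a::real_normed_vector" and k :: "real \<Rightarrow> real"
  assumes Y: "continuous_on {s..t} Y" and k: "k integrable_on {s..t}"
    and k_nonneg: "\<And>r. r \<in> {s..t} \<Longrightarrow> 0 \<le> k r" and small: "integral {s..t} k < 1"
    and increment: "\<And>x y M. s \<le> x \<Longrightarrow> x \<le> y \<Longrightarrow> y \<le> t \<Longrightarrow>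
      (\<And>r. r \<in> {x..y} \<Longrightarrow> norm (Y r) \<le> M) \<Longrightarrow> norm (Y y - Y x) \<le> M * integral {x..y} k"
    and c: "c \<in> {s..t}" "Y c = 0" and r: "r \<in> {s..t}"
  shows "Y r = 0"
proof -
  have "continuous_on {s..t} (\<lambda>r. norm (Y r))" by (intro continuous_intros Y)
  then obtain m where m: "m \<in> {s..t}" and max: "\<And>r. r \<in> {s..t} \<Longrightarrow> norm (Y r) \<le> norm (Y m)"
    using continuous_attains_sup[of "{s..t}" "\<lambda>r. norm (Y r)"] c by auto
  have "norm (Y m) = norm (Y (max m c) - Y (min m c))"
    using c by (auto simp: max_def min_def)
  also have "\<dots> \<le> norm (Y m) * integral {min m c..max m c} k"
    using m c by (intro increment max) auto
  also have "\<dots> \<le> norm (Y m) * integral {s..t} k"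
    using m c k_nonneg
    by (intro mult_left_mono integral_subset_le integrable_on_subinterval[OF k] k) auto
  finally have "norm (Y m) * (1 - integral {s..t} k) \<le> 0" by (simp add: algebra_simps)
  then have "Y m = 0" using small by (simp add: mult_le_0_iff)
  then show ?thesis using max[OF r] by simp
qed

lemma vanishing_if_increments_le:
  fixes Y :: "real \<Rightarrow> 'a::real_normed_vector" and k :: "real \<Rightarrow> real"
  assumes Y: "continuous_on {a..b} Y" and k: "k integrable_on {a..b}"
    and k_nonneg: "\<And>t. t \<in> {a..b} \<Longrightarrow> 0 \<le> k t"
    and increment: "\<And>s t M. a \<le> s \<Longrightarrow> s \<le> t \<Longrightarrow> t \<le> b \<Longrightarrow>
      (\<And>r. r \<in> {s..t} \<Longrightarrow> norm (Y r) \<le> M) \<Longrightarrow> norm (Y t - Y s) \<le> M * integral {s..t} k"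
    and c: "c \<in> {a..b}" "Y c = 0" and x: "x \<in> {a..b}"
  shows "Y x = 0"
proof -
  obtain \<delta> where "\<delta> > 0" and \<delta>: "\<And>s t. a \<le> s \<Longrightarrow> s \<le> t \<Longrightarrow> t \<le> b \<Longrightarrow> t - s < \<delta> \<Longrightarrow>
      norm (integral {s..t} k) < 1"
    using integral_small_on_short_intervals[OF k, of 1] by auto
  have zero_iff: "Y s = 0 \<longleftrightarrow> Y t = 0" if st: "a \<le> s" "s \<le> t" "t \<le> b" for s t
  proof -
    define P where "P = (\<lambda>s t. a \<le> s \<and> t \<le> b \<longrightarrow> (Y s = 0 \<longleftrightarrow> Y t = 0))"
    from \<open>s \<le> t\<close> have "P s t"
    proof (induction rule: Bolzano)
      case (local x)
      have "Y s = 0 \<longleftrightarrow> Y t = 0" if st: "a \<le> s" "s \<le> x" "x \<le> t" "t \<le> b" "t - s < \<delta>" for s t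
      proof -
        have zero: "Y r = 0" if "c \<in> {s..t}" "Y c = 0" "r \<in> {s..t}" for c r
        proof (rule vanishing_on_short_interval[OF _ _ _ _ increment that])
          show "continuous_on {s..t} Y" "k integrable_on {s..t}"
            using st by (auto intro: continuous_on_subset[OF Y] integrable_on_subinterval[OF k])
          show "integral {s..t} k < 1" using \<delta>[of s t] st by simp
        qed (use st k_nonneg in auto)
        show ?thesis using zero[of s t] zero[of t s] st by auto
      qed
      then show ?case using \<open>\<delta> > 0\<close> unfolding P_def by blast
    qed (auto simp: P_def)
    then show ?thesis using st by (simp add: P_def)
  qed
  show ?thesis using zero_iff[of c x] zero_iff[of x c] c x by (cases "c \<le> x") auto
qed

section \<open>Sturm--Liouville equations with integrable potential\<close>

definition sturm_liouville_on ::
  "real \<Rightarrow> real \<Rightarrow> (real \<Rightarrow> complex) \<Rightarrow> (real \<Rightarrow> complex) \<Rightarrow> (real \<Rightarrow> complex) \<Rightarrow> bool"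
  where "sturm_liouville_on a b V y y' \<longleftrightarrow>
    primitive_on a b y' y \<and> primitive_on a b (\<lambda>t. V t * y t) y'"

lemma sturm_liouville_on_continuous:
  assumes "sturm_liouville_on a b V y y'"
  shows "continuous_on {a..b} y" "continuous_on {a..b} y'"
  using assms by (auto simp: sturm_liouville_on_def intro: primitive_on_continuous)

lemma sturm_liouville_on_has_vector_derivative:
  assumes "sturm_liouville_on a b V y y'" "t \<in> {a..b}"
  shows "(y has_vector_derivative y' t) (at t within {a..b})"
  using assms
    primitive_on_iff_has_vector_derivative[OF sturm_liouville_on_continuous(2)[OF assms(1)]]
  by (auto simp: sturm_liouville_on_def)

lemma sturm_liouville_on_scale:
  assumes "sturm_liouville_on a b V f f'"
  shows "sturm_liouville_on a b V (\<lambda>t. c * f t) (\<lambda>t. c * f' t)"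
  using assms primitive_on_bounded_linear[OF _ bounded_linear_mult_right, of a b _ _ c]
  unfolding sturm_liouville_on_def by (fastforce simp: mult.left_commute)

lemma sturm_liouville_on_add:
  assumes "sturm_liouville_on a b V f f'" "sturm_liouville_on a b V g g'"
  shows "sturm_liouville_on a b V (\<lambda>t. f t + g t) (\<lambda>t. f' t + g' t)"
  using assms by (auto simp: sturm_liouville_on_def distrib_left intro: primitive_on_add)

lemma sturm_liouville_on_cong:
  assumes "sturm_liouville_on a b V f f'" "\<And>t. t \<in> {a..b} \<Longrightarrow> f t = g t"
  shows "sturm_liouville_on a b V g f'"
  using assms primitive_on_cong[of a b f' f f' g]
    primitive_on_cong[of a b "\<lambda>t. V t * f t" f' "\<lambda>t. V t * g t" f']
  by (auto simp: sturm_liouville_on_def)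

lemma sturm_liouville_on_cnj:
  assumes "sturm_liouville_on a b V f f'"
  shows "sturm_liouville_on a b (\<lambda>t. cnj (V t)) (\<lambda>t. cnj (f t)) (\<lambda>t. cnj (f' t))"
proof -
  have f: "primitive_on a b f' f" "primitive_on a b (\<lambda>t. V t * f t) f'"
    using assms by (simp_all add: sturm_liouville_on_def)
  show ?thesis
    using f[THEN primitive_on_bounded_linear[OF _ bounded_linear_cnj]]
    by (simp add: sturm_liouville_on_def)
qed

lemma sturm_liouville_on_absolutely_integrable:
  assumes y: "sturm_liouville_on a b V y y'" and V: "V absolutely_integrable_on {a..b}"
  shows "y' absolutely_integrable_on {a..b}" "(\<lambda>t. V t * y t) absolutely_integrable_on {a..b}"
  using sturm_liouville_on_continuous[OF y]
  by (auto intro: absolutely_integrable_continuous_real absolutely_integrable_mult_continuous[OF V])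

lemma lagrange_identity:
  assumes f: "sturm_liouville_on a b V f f'" and V: "V absolutely_integrable_on {a..b}"
    and g: "sturm_liouville_on a b U g g'" and U: "U absolutely_integrable_on {a..b}"
  shows "primitive_on a b (\<lambda>t. (U t - V t) * (f t * g t)) (\<lambda>t. f t * g' t - f' t * g t)"
proof -
  note integrable = sturm_liouville_on_absolutely_integrable[OF f V]
    sturm_liouville_on_absolutely_integrable[OF g U]
  have "primitive_on a b (\<lambda>t. f' t * g' t + f t * (U t * g t)) (\<lambda>t. f t * g' t)"
    using f g by (intro primitive_on_mult integrable) (simp_all add: sturm_liouville_on_def)
  moreover have "primitive_on a b (\<lambda>t. V t * f t * g t + f' t * g' t) (\<lambda>t. f' t * g t)"
    using f g by (intro primitive_on_mult integrable) (simp_all add: sturm_liouville_on_def)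
  then have "primitive_on a b (\<lambda>t. - (V t * f t * g t + f' t * g' t)) (\<lambda>t. - (f' t * g t))"
    by (rule primitive_on_bounded_linear[where h = uminus])
      (rule bounded_linear_minus[OF bounded_linear_ident])
  ultimately have "primitive_on a b
      (\<lambda>t. f' t * g' t + f t * (U t * g t) + - (V t * f t * g t + f' t * g' t))
      (\<lambda>t. f t * g' t + - (f' t * g t))"
    by (rule primitive_on_add)
  then show ?thesis by (simp add: algebra_simps)
qed

lemma wronskian_constant:
  assumes f: "sturm_liouville_on a b V f f'" and g: "sturm_liouville_on a b V g g'"
    and V: "V absolutely_integrable_on {a..b}" and t: "t \<in> {a..b}"
  shows "f t * g' t - f' t * g t = f a * g' a - f' a * g a"
proof -
  have "((\<lambda>s. (V s - V s) * (f s * g s)) has_integral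
      f t * g' t - f' t * g t - (f a * g' a - f' a * g a)) {a..t}"
    using lagrange_identity[OF f V g V] t unfolding primitive_on_def by blast
  then show ?thesis by simp
qed

lemma sturm_liouville_on_increment_le:
  assumes y: "sturm_liouville_on a b V y y'" and V: "V absolutely_integrable_on {a..b}"
    and st: "a \<le> s" "s \<le> t" "t \<le> b"
    and M: "\<And>r. r \<in> {s..t} \<Longrightarrow> norm (y r, y' r) \<le> M"
  shows "norm ((y t, y' t) - (y s, y' s)) \<le> M * integral {s..t} (\<lambda>r. 1 + norm (V r))"
proof -
  have V_norm: "(\<lambda>r. norm (V r)) integrable_on {s..t}"
    using V st by (auto simp: absolutely_integrable_on_def intro: integrable_on_subinterval)
  have bounds: "norm (y r) \<le> M" "norm (y' r) \<le> M" if "r \<in> {s..t}" for r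
    using M[OF that] norm_fst_le[of "y r" "y' r"] norm_snd_le[of "y' r" "y r"] by linarith+
  have "norm (y t - y s) \<le> integral {s..t} (\<lambda>_. M)"
    using y st bounds has_integral_const_real[of M s t] unfolding sturm_liouville_on_def
    by (intro has_integral_norm_le[OF primitive_on_increment]) auto
  moreover have "norm (y' t - y' s) \<le> integral {s..t} (\<lambda>r. norm (V r) * M)"
    using y st bounds V_norm unfolding sturm_liouville_on_def
    by (intro has_integral_norm_le[OF primitive_on_increment integrable_integral])
      (auto simp: norm_mult intro!: mult_left_mono integrable_on_mult_left)
  moreover have "M * integral {s..t} (\<lambda>r. 1 + norm (V r))
      = M * (t - s) + M * integral {s..t} (\<lambda>r. norm (V r))"
    using st V_norm by (subst integral_add) (auto simp: algebra_simps)
  moreover have "norm ((y t, y' t) - (y s, y' s)) \<le> norm (y t - y s) + norm (y' t - y' s)"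
    using norm_Pair_le by simp
  ultimately show ?thesis using st by (simp add: algebra_simps)
qed

lemma sturm_liouville_on_unique:
  assumes y: "sturm_liouville_on a b V y y'" and V: "V absolutely_integrable_on {a..b}"
    and c: "c \<in> {a..b}" "y c = 0" "y' c = 0" and t: "t \<in> {a..b}"
  shows "y t = 0" "y' t = 0"
proof -
  have "(y t, y' t) = 0"
  proof (rule vanishing_if_increments_le[OF _ _ _ sturm_liouville_on_increment_le[OF y V]])
    show "continuous_on {a..b} (\<lambda>t. (y t, y' t))"
      by (intro continuous_intros sturm_liouville_on_continuous[OF y])
    show "(\<lambda>r. 1 + norm (V r)) integrable_on {a..b}"
      using V by (auto simp: absolutely_integrable_on_def intro: integrable_add)
  qed (use c t in \<open>auto simp: zero_prod_def\<close>)
  then show "y t = 0" "y' t = 0" by (simp_all add: zero_prod_def)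
qed

lemma sturm_liouville_on_proportional:
  assumes V: "V absolutely_integrable_on {a..b}"
    and w: "sturm_liouville_on a b V w w'" "w a = 0" "w' a = 1"
    and g: "sturm_liouville_on a b V g g'" "g a = 0" and t: "t \<in> {a..b}"
  shows "g t = g' a * w t" "g' t = g' a * w' t"
proof -
  have "sturm_liouville_on a b V (\<lambda>t. g t + - g' a * w t) (\<lambda>t. g' t + - g' a * w' t)"
    by (rule sturm_liouville_on_add[OF g(1) sturm_liouville_on_scale[OF w(1)]])
  from sturm_liouville_on_unique[OF this V, of a t] show "g t = g' a * w t" "g' t = g' a * w' t"
    using w g t by auto
qed

text \<open>Adding the constant Wronskian to the derivative of \<open>g w\<close> leaves \<open>2 g w'\<close>.\<close>

lemma dirichlet_endpoint_integral:
  assumes "a \<le> b" and V: "V absolutely_integrable_on {a..b}"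
    and w: "sturm_liouville_on a b V w w'" "w a = 0" "w b = 0"
    and g: "sturm_liouville_on a b V g g'"
  shows "((\<lambda>t. 2 * (g t * w' t)) has_integral of_real (b - a) * (g a * w' a)) {a..b}"
proof -
  have "((\<lambda>t. g' t * w t + g t * w' t) has_integral g b * w b - g a * w a) {a..b}"
    using \<open>a \<le> b\<close> g w(1) primitive_on_mult[of a b g' g w' w]
      sturm_liouville_on_absolutely_integrable[OF g V]
      sturm_liouville_on_absolutely_integrable[OF w(1) V]
    by (auto simp: sturm_liouville_on_def primitive_on_def)
  moreover have "((\<lambda>t. g t * w' t - g' t * w t) has_integral of_real (b - a) * (g a * w' a)) {a..b}"
    using wronskian_constant[OF g w(1) V] w(2) \<open>a \<le> b\<close> has_integral_const_real[of "g a * w' a" a b]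
    by (subst has_integral_cong[where g="\<lambda>_. g a * w' a"]) (auto simp: scaleR_conv_of_real)
  ultimately have "((\<lambda>t. (g' t * w t + g t * w' t) + (g t * w' t - g' t * w t))
      has_integral g b * w b - g a * w a + of_real (b - a) * (g a * w' a)) {a..b}"
    by (rule has_integral_add)
  then show ?thesis using w by (simp add: algebra_simps)
qed

lemma integral_power2_le:
  fixes g :: "real \<Rightarrow> real"
  assumes "a \<le> b" and g: "continuous_on {a..b} g"
  shows "(integral {a..b} g)\<^sup>2 \<le> (b - a) * integral {a..b} (\<lambda>t. (g t)\<^sup>2)"
proof (cases "a = b")
  case False
  define m where "m = integral {a..b} g / (b - a)"
  have mean: "integral {a..b} g = m * (b - a)" using False by (simp add: m_def)
  have "((\<lambda>t. (g t)\<^sup>2 - 2 * m * g t + m\<^sup>2) has_integral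
      (integral {a..b} (\<lambda>t. (g t)\<^sup>2) - 2 * m * integral {a..b} g + (b - a) * m\<^sup>2)) {a..b}"
    using has_integral_const_real[of "m\<^sup>2" a b] \<open>a \<le> b\<close>
    by (intro has_integral_add has_integral_diff has_integral_mult_right integrable_integral
         integrable_continuous_real continuous_intros g) simp
  then have "0 \<le> integral {a..b} (\<lambda>t. (g t)\<^sup>2) - 2 * m * integral {a..b} g + (b - a) * m\<^sup>2"
  proof (rule has_integral_nonneg)
    show "0 \<le> (g t)\<^sup>2 - 2 * m * g t + m\<^sup>2" for t
      using zero_le_power2[of "g t - m"] by (simp add: power2_diff algebra_simps)
  qed
  then have "(b - a) * (m\<^sup>2 * (b - a)) \<le> (b - a) * integral {a..b} (\<lambda>t. (g t)\<^sup>2)"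
    using \<open>a \<le> b\<close> by (intro mult_left_mono) (simp_all add: mean power2_eq_square algebra_simps)
  then show ?thesis by (simp add: mean power2_eq_square algebra_simps)
qed simp

lemma dirichlet_endpoint_le_L2_norm:
  assumes "a \<le> b" and V: "V absolutely_integrable_on {a..b}"
    and w: "sturm_liouville_on a b V w w'" "w a = 0" "w b = 0"
  obtains C where "\<And>g g'. sturm_liouville_on a b V g g' \<Longrightarrow>
    (cmod (of_real (b - a) * (g a * w' a)))\<^sup>2 \<le> C * integral {a..b} (\<lambda>t. (cmod (g t))\<^sup>2)"
proof -
  have "bounded (w' ` {a..b})"
    by (intro compact_imp_bounded compact_continuous_image
        sturm_liouville_on_continuous[OF w(1)]) auto
  then obtain M where M: "\<And>t. t \<in> {a..b} \<Longrightarrow> cmod (w' t) \<le> M" unfolding bounded_iff by blast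
  show ?thesis
  proof (rule that)
    fix g g' assume g: "sturm_liouville_on a b V g g'"
    have cont: "continuous_on {a..b} (\<lambda>t. cmod (g t))"
      by (intro continuous_intros sturm_liouville_on_continuous[OF g])
    have "cmod (of_real (b - a) * (g a * w' a)) \<le> 2 * M * integral {a..b} (\<lambda>t. cmod (g t))"
    proof (rule has_integral_norm_le[OF dirichlet_endpoint_integral[OF \<open>a \<le> b\<close> V w g]])
      show "((\<lambda>t. 2 * M * cmod (g t)) has_integral 2 * M * integral {a..b} (\<lambda>t. cmod (g t))) {a..b}"
        by (intro has_integral_mult_right integrable_integral integrable_continuous_real cont)
      show "cmod (2 * (g t * w' t)) \<le> 2 * M * cmod (g t)" if "t \<in> {a..b}" for t
        using mult_right_mono[OF M[OF that], of "cmod (g t)"] by (simp add: norm_mult mult_ac)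
    qed
    then have "(cmod (of_real (b - a) * (g a * w' a)))\<^sup>2
        \<le> (2 * M)\<^sup>2 * (integral {a..b} (\<lambda>t. cmod (g t)))\<^sup>2"
      by (metis norm_ge_zero power_mono power_mult_distrib)
    also have "\<dots> \<le> (2 * M)\<^sup>2 * ((b - a) * integral {a..b} (\<lambda>t. (cmod (g t))\<^sup>2))"
      by (intro mult_left_mono integral_power2_le cont \<open>a \<le> b\<close>) auto
    finally show "(cmod (of_real (b - a) * (g a * w' a)))\<^sup>2
        \<le> (2 * M)\<^sup>2 * (b - a) * integral {a..b} (\<lambda>t. (cmod (g t))\<^sup>2)" by simp
  qed
qed

abbreviation potential :: "(real \<Rightarrow> real) \<Rightarrow> complex \<Rightarrow> real \<Rightarrow> complex" where
  "potential q \<mu> \<equiv> \<lambda>t. complex_of_real (q t) - \<mu>"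

lemma dirichlet_eigenvalue_real:
  assumes "a < b" and V: "\<And>\<mu>. potential q \<mu> absolutely_integrable_on {a..b}"
    and y: "sturm_liouville_on a b (potential q \<mu>) y y'" "y a = 0" "y b = 0"
    and nontrivial: "\<exists>t\<in>{a..b}. y t \<noteq> 0"
  shows "\<mu> \<in> \<real>"
proof -
  define I where "I = integral {a..b} (\<lambda>t. (cmod (y t))\<^sup>2)"
  have cont: "continuous_on {a..b} (\<lambda>t. (cmod (y t))\<^sup>2)"
    by (intro continuous_intros sturm_liouville_on_continuous[OF y(1)])
  have "sturm_liouville_on a b (potential q (cnj \<mu>)) (\<lambda>t. cnj (y t)) (\<lambda>t. cnj (y' t))"
    using sturm_liouville_on_cnj[OF y(1)] by simp
  from lagrange_identity[OF y(1) V this V]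
  have "((\<lambda>t. (\<mu> - cnj \<mu>) * (y t * cnj (y t))) has_integral 0) {a..b}"
    using \<open>a < b\<close> y(2,3) by (auto simp: primitive_on_def dest: bspec[where x = b])
  moreover have "((\<lambda>t. (\<mu> - cnj \<mu>) * (y t * cnj (y t))) has_integral
      (\<mu> - cnj \<mu>) * of_real I) {a..b}"
    unfolding complex_norm_square[symmetric] I_def
    by (intro has_integral_mult_right has_integral_of_real integrable_integral
        integrable_continuous_real cont)
  ultimately have "(\<mu> - cnj \<mu>) * of_real I = 0" using has_integral_unique by blast
  moreover have "I \<noteq> 0"
    unfolding I_def using integral_eq_0_iff[OF cont \<open>a < b\<close>] nontrivial by auto
  ultimately show ?thesis by (simp add: Reals_cnj_iff)
qed

section \<open>Square-summable solutions of the Kirchhoff recurrence\<close>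

lemma norm_add_power2_le:
  fixes x y :: "'a::real_normed_vector"
  shows "(norm (x + y))\<^sup>2 \<le> 2 * (norm x)\<^sup>2 + 2 * (norm y)\<^sup>2"
proof -
  have "(norm (x + y))\<^sup>2 \<le> (norm x + norm y)\<^sup>2"
    by (intro power_mono norm_triangle_ineq) auto
  also have "\<dots> \<le> 2 * (norm x)\<^sup>2 + 2 * (norm y)\<^sup>2"
    using sum_squares_bound[of "norm x" "norm y"] by (simp add: power2_sum)
  finally show ?thesis .
qed

lemma l2_seq_add:
  assumes "l2_seq x" "l2_seq y"
  shows "l2_seq (\<lambda>n. x n + y n)"
  unfolding l2_seq_def
proof (rule summable_on_comparison_test)
  show "(\<lambda>n. 2 * (cmod (x n))\<^sup>2 + 2 * (cmod (y n))\<^sup>2) summable_on UNIV"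
    using assms unfolding l2_seq_def by (intro summable_on_add summable_on_cmult_right)
qed (auto intro: norm_add_power2_le)

lemma l2_seq_cmult:
  assumes "l2_seq x"
  shows "l2_seq (\<lambda>n. c * x n)"
proof -
  have "(\<lambda>n. (cmod c)\<^sup>2 * (cmod (x n))\<^sup>2) summable_on UNIV"
    using assms unfolding l2_seq_def by (rule summable_on_cmult_right)
  then show ?thesis by (simp add: l2_seq_def norm_mult power_mult_distrib)
qed

lemma l2_seq_translate:
  assumes "l2_seq x"
  shows "l2_seq (\<lambda>n. x (n - m))"
proof -
  have "bij_betw (\<lambda>n. n - m) UNIV (UNIV :: int set)"
    by (rule bij_betwI[where g="\<lambda>n. n + m"]) auto
  from summable_on_reindex_bij_betw[OF this, of "\<lambda>n. (cmod (x n))\<^sup>2"] assms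
  show ?thesis by (simp add: l2_seq_def)
qed

lemma l2_seq_finite_support:
  assumes "finite {n. x n \<noteq> 0}"
  shows "l2_seq x"
proof -
  have "(\<lambda>n. (cmod (x n))\<^sup>2) summable_on {n. x n \<noteq> 0}" using assms by (rule summable_on_finite)
  then show ?thesis
    unfolding l2_seq_def by (rule summable_on_cong_neutral[THEN iffD1, rotated -1]) auto
qed

lemma l2_seq_periodic_imp_zero:
  assumes periodic: "\<And>n. x n = x (n - 1)" and l2: "l2_seq x"
  shows "x n = 0"
proof -
  have const: "x n = x 0" for n
  proof (induction n rule: int_induct[where k=0])
    case (step1 i)
    then show ?case using periodic[of "i + 1"] by simp
  next
    case (step2 i)
    then show ?case using periodic[of i] by simp
  qed simp
  have "(\<lambda>n. (cmod (x n))\<^sup>2) = (\<lambda>_. (cmod (x 0))\<^sup>2)" by (rule ext, subst const, rule refl)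
  then have "(\<lambda>n::int. (cmod (x 0))\<^sup>2) summable_on UNIV" using l2 by (simp only: l2_seq_def)
  then have "(cmod (x 0))\<^sup>2 = 0" using infsum_diverge_constant[OF infinite_UNIV_int] by blast
  then show ?thesis using const by simp
qed

lemma atLeastAtMost_1_6: "{1..6::nat} = {1, 2, 3, 4, 5, 6}"
  by auto

definition l2_amplitudes :: "(int \<Rightarrow> nat \<Rightarrow> complex) \<Rightarrow> bool" where
  "l2_amplitudes A \<longleftrightarrow> (\<forall>j\<in>{1..6}. l2_seq (\<lambda>n. A n j))"

text \<open>\<open>B \<nu> l j\<close> is the amplitude on edge \<open>j\<close> of cell \<open>l\<close> of the basic solution \<open>\<psi>\<^sup>(\<^sup>0\<^sup>,\<^sup>\<nu>\<^sup>)\<close>.\<close>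

definition superposition ::
  "(nat \<Rightarrow> nat \<Rightarrow> nat \<Rightarrow> complex) \<Rightarrow> (int \<Rightarrow> nat \<Rightarrow> complex) \<Rightarrow> int \<Rightarrow> nat \<Rightarrow> complex" where
  "superposition B h n j = (\<Sum>\<nu>\<in>{1,2}. B \<nu> 0 j * h n \<nu> + B \<nu> 1 j * h (n - 1) \<nu>)"

lemma l2_amplitudes_superposition:
  assumes "l2_seq (\<lambda>n. h n 1)" "l2_seq (\<lambda>n. h n 2)"
  shows "l2_amplitudes (superposition B h)"
proof -
  have "l2_seq (\<lambda>n. B \<nu> 0 j * h n \<nu> + B \<nu> 1 j * h (n - 1) \<nu>)" if "\<nu> \<in> {1, 2}" for \<nu> j
    using that assms by (intro l2_seq_add l2_seq_cmult l2_seq_translate[of "\<lambda>n. h n \<nu>"]) auto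
  from l2_seq_add[OF this[of 1] this[of 2]] show ?thesis
    by (simp add: l2_amplitudes_def superposition_def)
qed

definition unit_coords :: "int \<Rightarrow> nat \<Rightarrow> int \<Rightarrow> nat \<Rightarrow> complex" where
  "unit_coords n \<nu> m \<nu>' = of_bool (m = n \<and> \<nu>' = \<nu>)"

lemma superposition_unit_coords:
  assumes "\<nu> \<in> {1, 2}"
  shows "superposition B (unit_coords n \<nu>) m j
    = (if m = n then B \<nu> 0 j else if m = n + 1 then B \<nu> 1 j else 0)"
  using assms by (auto simp: superposition_def unit_coords_def)

lemma l2_seq_unit_coords: "l2_seq (\<lambda>m. unit_coords n \<nu> m \<nu>')"
proof (rule l2_seq_finite_support)
  show "finite {m. unit_coords n \<nu> m \<nu>' \<noteq> 0}"
    by (rule finite_subset[of _ "{n}"]) (auto simp: unit_coords_def)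
qed

lemma has_sum_superposition:
  "((\<lambda>(n, \<nu>). h n \<nu> * superposition B (unit_coords n \<nu>) m j) has_sum superposition B h m j)
    (UNIV \<times> {1, 2})"
proof (rule has_sum_finite_neutralI[where B = "{m, m - 1} \<times> {1, 2}"])
  show "superposition B h m j = (\<Sum>(n, \<nu>)\<in>{m, m - 1} \<times> {1, 2}.
      h n \<nu> * superposition B (unit_coords n \<nu>) m j)"
    by (simp add: sum.cartesian_product[symmetric] superposition_unit_coords)
      (simp add: superposition_def algebra_simps)
qed (auto simp: superposition_unit_coords split: if_splits)

text \<open>The amplitude of a family on the edge \<open>(n, j)\<close> is its derivative at \<open>0\<close>; the one at \<open>1\<close> is
  \<open>\<phi>\<close> times as large. Here \<open>\<omega>\<^sub>1\<close>, \<open>\<omega>\<^sub>2\<close>, \<open>\<zeta>\<close> stand for \<open>e\<^sup>i\<^sup>a\<^sup>1\<close>, \<open>e\<^sup>i\<^sup>a\<^sup>2\<close>, \<open>s\<^sup>k\<close>.\<close>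

locale unimodular_kirchhoff =
  fixes \<omega>\<^sub>1 \<omega>\<^sub>2 \<zeta> \<phi> :: complex
  assumes norm_omega1: "norm \<omega>\<^sub>1 = 1" and norm_omega2: "norm \<omega>\<^sub>2 = 1" and norm_zeta: "norm \<zeta> = 1"
    and phi_real: "\<phi> \<in> \<real>"
begin

definition kirchhoff :: "(int \<Rightarrow> nat \<Rightarrow> complex) \<Rightarrow> bool" where
  "kirchhoff A \<longleftrightarrow> (\<forall>n.
     \<omega>\<^sub>1 * \<phi> * A n 1 = A n 2 + A n 5 \<and>
     \<omega>\<^sub>2 * \<phi> * A n 2 = A n 3 + A n 6 \<and>
     \<omega>\<^sub>1 * \<phi> * (A n 3 + A (n - 1) 6) = A n 4 \<and>
     \<omega>\<^sub>2 * \<zeta> * \<phi> * A n 4 + inverse \<omega>\<^sub>1 * \<phi> * A (n - 1) 5 = A n 1)"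

definition monodromy :: complex where
  "monodromy = \<zeta> * (\<omega>\<^sub>1 * \<omega>\<^sub>2)\<^sup>2"

definition \<kappa>\<^sub>1 :: complex where "\<kappa>\<^sub>1 = 1 - monodromy * \<phi>\<^sup>2"

definition \<kappa>\<^sub>2 :: complex where "\<kappa>\<^sub>2 = 1 - monodromy * \<phi> ^ 4"

definition degenerate :: bool where
  "degenerate \<longleftrightarrow> monodromy = 1 \<and> \<phi>\<^sup>2 = 1"

definition coords :: "(int \<Rightarrow> nat \<Rightarrow> complex) \<Rightarrow> int \<Rightarrow> nat \<Rightarrow> complex" where
  "coords A n \<nu> =
     (if degenerate then (if \<nu> = 1 then A n 1 else A n 2)
      else if \<nu> = 1 then (A n 5 + \<zeta> * \<phi> * (\<omega>\<^sub>1\<^sup>2 * \<omega>\<^sub>2) * A n 6) / (\<kappa>\<^sub>1 * \<kappa>\<^sub>2)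
      else - (\<omega>\<^sub>1 * A n 6 + \<phi> * (\<omega>\<^sub>1 * \<omega>\<^sub>2) * A n 5) / (\<kappa>\<^sub>1 * \<kappa>\<^sub>2))"

lemma kirchhoffD:
  assumes "kirchhoff A"
  shows "\<omega>\<^sub>1 * \<phi> * A n 1 = A n 2 + A n 5" "\<omega>\<^sub>2 * \<phi> * A n 2 = A n 3 + A n 6"
    "\<omega>\<^sub>1 * \<phi> * (A n 3 + A (n - 1) 6) = A n 4"
    "\<omega>\<^sub>2 * \<zeta> * \<phi> * A n 4 + inverse \<omega>\<^sub>1 * \<phi> * A (n - 1) 5 = A n 1"
  using assms by (auto simp: kirchhoff_def)

lemma kirchhoff_add_mult:
  assumes "kirchhoff A" "kirchhoff B"
  shows "kirchhoff (\<lambda>n j. A n j + c * B n j)"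
  unfolding kirchhoff_def
proof
  fix n
  show "\<omega>\<^sub>1 * \<phi> * (A n 1 + c * B n 1) = A n 2 + c * B n 2 + (A n 5 + c * B n 5) \<and>
      \<omega>\<^sub>2 * \<phi> * (A n 2 + c * B n 2) = A n 3 + c * B n 3 + (A n 6 + c * B n 6) \<and>
      \<omega>\<^sub>1 * \<phi> * (A n 3 + c * B n 3 + (A (n - 1) 6 + c * B (n - 1) 6)) = A n 4 + c * B n 4 \<and>
      \<omega>\<^sub>2 * \<zeta> * \<phi> * (A n 4 + c * B n 4) + inverse \<omega>\<^sub>1 * \<phi> * (A (n - 1) 5 + c * B (n - 1) 5)
        = A n 1 + c * B n 1"
    using kirchhoffD[OF assms(1), of n] kirchhoffD[OF assms(2), of n] by (intro conjI; algebra)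
qed

lemma coords_add_mult: "coords (\<lambda>n j. A n j + c * B n j) n \<nu> = coords A n \<nu> + c * coords B n \<nu>"
  by (simp add: coords_def add_divide_distrib diff_divide_distrib algebra_simps)

lemma coords_cong:
  assumes "\<And>j. j \<in> {1..6} \<Longrightarrow> A n j = B n j"
  shows "coords A n \<nu> = coords B n \<nu>"
  using assms by (simp add: coords_def)

lemma l2_seq_coords:
  assumes "l2_amplitudes A"
  shows "l2_seq (\<lambda>n. coords A n \<nu>)"
proof -
  have A: "l2_seq (\<lambda>n. A n 1)" "l2_seq (\<lambda>n. A n 2)" "l2_seq (\<lambda>n. A n 5)" "l2_seq (\<lambda>n. A n 6)"
    using assms by (simp_all add: l2_amplitudes_def atLeastAtMost_1_6)
  have "l2_seq (\<lambda>n. (1 / (\<kappa>\<^sub>1 * \<kappa>\<^sub>2)) * (A n 5 + \<zeta> * \<phi> * (\<omega>\<^sub>1\<^sup>2 * \<omega>\<^sub>2) * A n 6))"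
       "l2_seq (\<lambda>n. (1 / (\<kappa>\<^sub>1 * \<kappa>\<^sub>2)) * (- \<omega>\<^sub>1 * A n 6 + - (\<phi> * (\<omega>\<^sub>1 * \<omega>\<^sub>2)) * A n 5))"
    by (intro l2_seq_cmult l2_seq_add A)+
  with A show ?thesis by (cases degenerate; cases "\<nu> = 1") (simp_all add: coords_def)
qed

lemma kappa_nonzero:
  assumes "\<not> degenerate"
  shows "\<kappa>\<^sub>1 \<noteq> 0" "\<kappa>\<^sub>2 \<noteq> 0"
proof -
  obtain r where r: "\<phi> = of_real r" using phi_real by (rule Reals_cases)
  then have phi_power: "\<phi> ^ m = of_real (r ^ m)" for m by simp
  have "norm monodromy = 1"
    by (simp add: monodromy_def norm_mult norm_power norm_omega1 norm_omega2 norm_zeta)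
  then have modulus: "x = 1" if "monodromy * of_real x = 1" "0 \<le> x" for x :: real
    using arg_cong[OF that(1), of norm] that(2) by (simp add: norm_mult)
  have degenerate: degenerate if "monodromy * of_real x = 1" "0 \<le> x" "x = 1 \<Longrightarrow> r\<^sup>2 = 1" for x
    using that modulus[of x] by (auto simp: degenerate_def phi_power)
  have "\<kappa>\<^sub>1 = 1 - monodromy * of_real (r\<^sup>2)" "\<kappa>\<^sub>2 = 1 - monodromy * of_real (r ^ 4)"
    by (simp_all only: \<kappa>\<^sub>1_def \<kappa>\<^sub>2_def phi_power)
  moreover have "r\<^sup>2 = 1" if "r ^ 4 = 1"
    by (rule power2_eq_imp_eq) (use that in auto)
  ultimately show "\<kappa>\<^sub>1 \<noteq> 0" "\<kappa>\<^sub>2 \<noteq> 0"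
    using assms degenerate[of "r\<^sup>2"] degenerate[of "r ^ 4"] by auto
qed

text \<open>The entries come from solving the relations. In the degenerate case the coordinates
  \<open>A n 1\<close> and \<open>A n 2\<close> give \<open>A n 5\<close>, and square summability forces
  \<open>A n 6 = - \<omega>\<^sub>2 \<phi> A n 5\<close>. In the generic case the coordinates give \<open>A n 5\<close> and \<open>A n 6\<close>, and
  eliminating the edges \<open>2\<close>, \<open>3\<close>, \<open>4\<close> gives \<open>\<kappa>\<^sub>2 A n 1\<close>.\<close>

definition degenerate_basis :: "nat \<Rightarrow> nat \<Rightarrow> nat \<Rightarrow> complex" where
  "degenerate_basis \<nu> l j =
     (if \<nu> = 1 then
        (if l = 0 then [1, 0, \<omega>\<^sub>1 * \<omega>\<^sub>2, \<omega>\<^sub>1\<^sup>2 * \<omega>\<^sub>2 * \<phi>, \<omega>\<^sub>1 * \<phi>, - (\<omega>\<^sub>1 * \<omega>\<^sub>2)]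
         else [0, 0, 0, - (\<omega>\<^sub>1\<^sup>2 * \<omega>\<^sub>2 * \<phi>), 0, 0])
      else
        (if l = 0 then [0, 1, 0, 0, - 1, \<omega>\<^sub>2 * \<phi>]
         else [0, 0, 0, \<omega>\<^sub>1 * \<omega>\<^sub>2, 0, 0])) ! (j - 1)"

definition generic_basis :: "nat \<Rightarrow> nat \<Rightarrow> nat \<Rightarrow> complex" where
  "generic_basis \<nu> l j =
     (if \<nu> = 1 then
        (if l = 0 then [0, - \<kappa>\<^sub>2, 0, 0, \<kappa>\<^sub>2, - (\<kappa>\<^sub>2 * \<phi> * \<omega>\<^sub>2)]
         else [\<kappa>\<^sub>1 * \<phi> / \<omega>\<^sub>1, \<kappa>\<^sub>1 * \<phi>\<^sup>2, \<kappa>\<^sub>1 * \<omega>\<^sub>2 * \<phi> ^ 3, \<phi>\<^sup>2 * (\<phi>\<^sup>2 - 1) * \<omega>\<^sub>1 * \<omega>\<^sub>2, 0, 0])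
      else
        (if l = 0 then [\<kappa>\<^sub>1 * \<omega>\<^sub>2 * \<zeta> * \<phi>\<^sup>2, \<zeta> * \<phi> * \<omega>\<^sub>1 * \<omega>\<^sub>2 * (\<phi>\<^sup>2 - 1), \<kappa>\<^sub>1 / \<omega>\<^sub>1, \<kappa>\<^sub>1 * \<phi>,
           \<kappa>\<^sub>2 * \<zeta> * \<phi> * \<omega>\<^sub>1 * \<omega>\<^sub>2, - (\<kappa>\<^sub>2 / \<omega>\<^sub>1)]
         else [0, 0, 0, - (\<kappa>\<^sub>2 * \<phi>), 0, 0])) ! (j - 1)"

definition basis :: "nat \<Rightarrow> nat \<Rightarrow> nat \<Rightarrow> complex" where
  "basis = (if degenerate then degenerate_basis else generic_basis)"

lemma omega1_inverse: "\<omega>\<^sub>1 * inverse \<omega>\<^sub>1 = 1"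
  using norm_omega1 by (intro right_inverse) auto

lemma superposition_degenerate_basis:
  "superposition degenerate_basis h n 1 = h n 1"
  "superposition degenerate_basis h n 2 = h n 2"
  "superposition degenerate_basis h n 3 = \<omega>\<^sub>1 * \<omega>\<^sub>2 * h n 1"
  "superposition degenerate_basis h n 4
     = \<omega>\<^sub>1\<^sup>2 * \<omega>\<^sub>2 * \<phi> * (h n 1 - h (n - 1) 1) + \<omega>\<^sub>1 * \<omega>\<^sub>2 * h (n - 1) 2"
  "superposition degenerate_basis h n 5 = \<omega>\<^sub>1 * \<phi> * h n 1 - h n 2"
  "superposition degenerate_basis h n 6 = \<omega>\<^sub>2 * \<phi> * h n 2 - \<omega>\<^sub>1 * \<omega>\<^sub>2 * h n 1"
  by (simp_all add: superposition_def degenerate_basis_def algebra_simps)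

lemma superposition_generic_basis:
  "superposition generic_basis h n 1 = \<kappa>\<^sub>1 * (\<omega>\<^sub>2 * \<zeta> * \<phi>\<^sup>2 * h n 2 + inverse \<omega>\<^sub>1 * \<phi> * h (n - 1) 1)"
  "superposition generic_basis h n 2
     = \<zeta> * \<phi> * \<omega>\<^sub>1 * \<omega>\<^sub>2 * (\<phi>\<^sup>2 - 1) * h n 2 - \<kappa>\<^sub>2 * h n 1 + \<kappa>\<^sub>1 * \<phi>\<^sup>2 * h (n - 1) 1"
  "superposition generic_basis h n 3 = \<kappa>\<^sub>1 * (inverse \<omega>\<^sub>1 * h n 2 + \<omega>\<^sub>2 * \<phi> ^ 3 * h (n - 1) 1)"
  "superposition generic_basis h n 4
     = \<kappa>\<^sub>1 * \<phi> * h n 2 - \<kappa>\<^sub>2 * \<phi> * h (n - 1) 2 + \<phi>\<^sup>2 * (\<phi>\<^sup>2 - 1) * \<omega>\<^sub>1 * \<omega>\<^sub>2 * h (n - 1) 1"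
  "superposition generic_basis h n 5 = \<kappa>\<^sub>2 * (h n 1 + \<zeta> * \<phi> * \<omega>\<^sub>1 * \<omega>\<^sub>2 * h n 2)"
  "superposition generic_basis h n 6 = - \<kappa>\<^sub>2 * (\<phi> * \<omega>\<^sub>2 * h n 1 + inverse \<omega>\<^sub>1 * h n 2)"
  by (simp_all add: superposition_def generic_basis_def divide_inverse algebra_simps)

lemma degenerateD:
  assumes degenerate
  shows "\<zeta> * (\<omega>\<^sub>1 * \<omega>\<^sub>2)\<^sup>2 = 1" "\<phi>\<^sup>2 = 1"
  using assms by (simp_all add: degenerate_def monodromy_def)

lemma kirchhoff_superposition: "kirchhoff (superposition basis h)"
  unfolding kirchhoff_def
proof
  fix n
  show "\<omega>\<^sub>1 * \<phi> * superposition basis h n 1 = superposition basis h n 2 + superposition basis h n 5 \<and>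
    \<omega>\<^sub>2 * \<phi> * superposition basis h n 2 = superposition basis h n 3 + superposition basis h n 6 \<and>
    \<omega>\<^sub>1 * \<phi> * (superposition basis h n 3 + superposition basis h (n - 1) 6)
      = superposition basis h n 4 \<and>
    \<omega>\<^sub>2 * \<zeta> * \<phi> * superposition basis h n 4 + inverse \<omega>\<^sub>1 * \<phi> * superposition basis h (n - 1) 5
      = superposition basis h n 1"
  proof (cases degenerate)
    case True
    show ?thesis
      unfolding basis_def if_P[OF True] superposition_degenerate_basis
      using degenerateD[OF True] omega1_inverse by (intro conjI; (algebra | simp))
  next
    case False
    show ?thesis
      unfolding basis_def if_not_P[OF False] superposition_generic_basis
      using \<kappa>\<^sub>1_def \<kappa>\<^sub>2_def monodromy_def omega1_inverse by (intro conjI; algebra)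
  qed
qed

lemma coords_superposition:
  assumes "\<nu> \<in> {1, 2}"
  shows "coords (superposition basis h) n \<nu> = h n \<nu>"
proof (cases degenerate)
  case True
  then show ?thesis
    using assms superposition_degenerate_basis(1,2)[of h n] by (auto simp: basis_def coords_def)
next
  case False
  let ?A = "superposition generic_basis h"
  have "?A n 5 + \<zeta> * \<phi> * (\<omega>\<^sub>1\<^sup>2 * \<omega>\<^sub>2) * ?A n 6 = \<kappa>\<^sub>1 * \<kappa>\<^sub>2 * h n 1"
       "- (\<omega>\<^sub>1 * ?A n 6 + \<phi> * (\<omega>\<^sub>1 * \<omega>\<^sub>2) * ?A n 5) = \<kappa>\<^sub>1 * \<kappa>\<^sub>2 * h n 2"
    unfolding superposition_generic_basis using \<kappa>\<^sub>1_def monodromy_def omega1_inverse by algebra+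
  with False assms show ?thesis using kappa_nonzero by (auto simp: coords_def basis_def)
qed

lemma degenerate_current_zero:
  assumes degenerate "kirchhoff A" "l2_amplitudes A"
  shows "\<omega>\<^sub>2 * \<phi> * A n 5 + A n 6 = 0"
proof (rule l2_seq_periodic_imp_zero[where x = "\<lambda>n. \<omega>\<^sub>2 * \<phi> * A n 5 + A n 6"])
  show "\<omega>\<^sub>2 * \<phi> * A n 5 + A n 6 = \<omega>\<^sub>2 * \<phi> * A (n - 1) 5 + A (n - 1) 6" for n
    using kirchhoffD[OF assms(2), of n] degenerateD[OF assms(1)] omega1_inverse by algebra
  show "l2_seq (\<lambda>n. \<omega>\<^sub>2 * \<phi> * A n 5 + A n 6)"
    using assms(3) by (intro l2_seq_add l2_seq_cmult) (auto simp: l2_amplitudes_def)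
qed

lemma coords_generic:
  assumes "\<not> degenerate"
  shows "\<kappa>\<^sub>1 * \<kappa>\<^sub>2 * coords A n 1 = A n 5 + \<zeta> * \<phi> * (\<omega>\<^sub>1\<^sup>2 * \<omega>\<^sub>2) * A n 6"
    "\<kappa>\<^sub>1 * \<kappa>\<^sub>2 * coords A n 2 = - (\<omega>\<^sub>1 * A n 6 + \<phi> * (\<omega>\<^sub>1 * \<omega>\<^sub>2) * A n 5)"
  using assms kappa_nonzero by (simp_all add: coords_def)

lemma degenerate_superposition_coords:
  assumes A: degenerate "kirchhoff A" "l2_amplitudes A" and j: "j \<in> {1..6}"
  shows "superposition degenerate_basis (coords A) n j = A n j"
proof -
  note relations = kirchhoffD[OF A(2), of n] kirchhoffD[OF A(2), of "n - 1"]
    degenerate_current_zero[OF A, of n] degenerate_current_zero[OF A, of "n - 1"]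
  have coords: "coords A m 1 = A m 1" "coords A m 2 = A m 2" for m
    using A(1) by (simp_all add: coords_def)
  have "\<forall>j\<in>{1, 2, 3, 4, 5, 6}. superposition degenerate_basis (coords A) n j = A n j"
    unfolding ball_simps simp_thms superposition_degenerate_basis coords
    using relations degenerateD[OF A(1)] by (intro conjI; algebra)
  with j show ?thesis unfolding atLeastAtMost_1_6 by blast
qed

lemma generic_superposition_coords:
  assumes generic: "\<not> degenerate" and A: "kirchhoff A" and j: "j \<in> {1..6}"
  shows "superposition generic_basis (coords A) n j = A n j"
proof -
  note relations = kirchhoffD[OF A]
  note params = \<kappa>\<^sub>1_def \<kappa>\<^sub>2_def monodromy_def omega1_inverse
  let ?S = "superposition generic_basis (coords A)"
  have "\<kappa>\<^sub>1 * ?S m 5 = \<kappa>\<^sub>1 * A m 5" "\<kappa>\<^sub>1 * ?S m 6 = \<kappa>\<^sub>1 * A m 6" for m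
    unfolding superposition_generic_basis
    using coords_generic[OF generic, of A m] params by algebra+
  then have edge5: "?S m 5 = A m 5" and edge6: "?S m 6 = A m 6" for m
    using kappa_nonzero[OF generic] by simp_all
  have edge1_relation: "\<kappa>\<^sub>2 * B n 1
      = \<omega>\<^sub>1 * \<omega>\<^sub>2 * \<zeta> * \<phi>\<^sup>2 * (B (n - 1) 6 - B n 6 - \<omega>\<^sub>2 * \<phi> * B n 5)
        + inverse \<omega>\<^sub>1 * \<phi> * B (n - 1) 5" if "kirchhoff B" for B
    using kirchhoffD[OF that, of n] params by algebra
  have S: "kirchhoff ?S"
    using kirchhoff_superposition[of "coords A"] generic by (simp add: basis_def)
  have "\<kappa>\<^sub>2 * ?S n 1 = \<kappa>\<^sub>2 * A n 1"
    unfolding edge1_relation[OF S] edge1_relation[OF A] edge5 edge6 ..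
  then have edge1: "?S n 1 = A n 1" using kappa_nonzero[OF generic] by simp
  have edge2: "?S n 2 = A n 2" using kirchhoffD(1)[OF S, of n] relations(1)[of n] edge1 edge5 by simp
  have edge3: "?S n 3 = A n 3" using kirchhoffD(2)[OF S, of n] relations(2)[of n] edge2 edge6 by simp
  have edge4: "?S n 4 = A n 4" using kirchhoffD(3)[OF S, of n] relations(3)[of n] edge3 edge6 by simp
  show ?thesis
    using j edge1 edge2 edge3 edge4 edge5 edge6 unfolding atLeastAtMost_1_6 by blast
qed

lemma superposition_coords:
  assumes "kirchhoff A" "l2_amplitudes A" "j \<in> {1..6}"
  shows "superposition basis (coords A) n j = A n j"
  using assms degenerate_superposition_coords generic_superposition_coords by (simp add: basis_def)

end

section \<open>Square integrability on the graph\<close>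

lemma sq_int01_measurable:
  assumes "sq_int01 g"
  shows "g \<in> borel_measurable (lebesgue_on {0..1})"
  using assms by (simp add: sq_int01_def measurable_on_iff_borel_measurable)

lemma sq_int01I:
  assumes g: "g \<in> borel_measurable (lebesgue_on {0..1})" and h: "h integrable_on {0..1}"
    and bound: "\<And>t. t \<in> {0..1} \<Longrightarrow> (cmod (g t))\<^sup>2 \<le> h t"
  shows "sq_int01 g"
  unfolding sq_int01_def
proof
  show "g measurable_on {0..1}" using g by (simp add: measurable_on_iff_borel_measurable)
  show "(\<lambda>t. (cmod (g t))\<^sup>2) integrable_on {0..1}"
    by (rule measurable_bounded_by_integrable_imp_integrable_real[OF _ h])
      (use g bound in auto)
qed

lemma sq_int01_cong:
  assumes y: "sq_int01 y" and eq: "\<And>t. t \<in> {0..1} \<Longrightarrow> x t = y t"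
  shows "sq_int01 x"
proof (rule sq_int01I)
  show "x \<in> borel_measurable (lebesgue_on {0..1})"
    using sq_int01_measurable[OF y] eq by (subst measurable_cong[where g = y]) auto
  show "(\<lambda>t. (cmod (y t))\<^sup>2) integrable_on {0..1}" using y by (simp add: sq_int01_def)
qed (simp add: eq)

lemma sq_int01_continuous:
  assumes "continuous_on {0..1} y"
  shows "sq_int01 y"
proof (rule sq_int01I)
  show "y \<in> borel_measurable (lebesgue_on {0..1})"
    by (rule continuous_imp_measurable_on_sets_lebesgue[OF assms]) auto
  show "(\<lambda>t. (cmod (y t))\<^sup>2) integrable_on {0..1}"
    by (intro integrable_continuous_real continuous_intros assms)
qed simp

lemma sq_int01_add:
  assumes g: "sq_int01 g" and h: "sq_int01 h"
  shows "sq_int01 (\<lambda>t. g t + h t)"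
proof (rule sq_int01I)
  show "(\<lambda>t. 2 * (cmod (g t))\<^sup>2 + 2 * (cmod (h t))\<^sup>2) integrable_on {0..1}"
    using g h unfolding sq_int01_def by (intro integrable_add integrable_on_mult_right) auto
qed (auto intro: norm_add_power2_le borel_measurable_add sq_int01_measurable g h)

lemma sq_int01_mult_continuous:
  assumes g: "sq_int01 g" and y: "continuous_on {0..1} y"
  shows "sq_int01 (\<lambda>t. g t * y t)"
proof -
  have "bounded (y ` {0..1})" by (intro compact_imp_bounded compact_continuous_image y) auto
  then obtain M where M: "\<And>t. t \<in> {0..1} \<Longrightarrow> cmod (y t) \<le> M" unfolding bounded_iff by blast
  show ?thesis
  proof (rule sq_int01I)
    show "(\<lambda>t. g t * y t) \<in> borel_measurable (lebesgue_on {0..1})"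
      by (intro borel_measurable_times sq_int01_measurable[OF g]
          sq_int01_measurable[OF sq_int01_continuous[OF y]])
    show "(\<lambda>t. (cmod (g t))\<^sup>2 * M\<^sup>2) integrable_on {0..1}"
      using g unfolding sq_int01_def by (intro integrable_on_mult_left) simp
    show "(cmod (g t * y t))\<^sup>2 \<le> (cmod (g t))\<^sup>2 * M\<^sup>2" if "t \<in> {0..1}" for t
      using M[OF that] by (auto simp: norm_mult power_mult_distrib intro!: mult_left_mono power_mono)
  qed
qed

lemma sq_int01_imp_absolutely_integrable:
  assumes g: "sq_int01 g"
  shows "g absolutely_integrable_on {0..1}"
proof (rule measurable_bounded_by_integrable_imp_absolutely_integrable[OF sq_int01_measurable[OF g]])
  show "(\<lambda>t. (cmod (g t))\<^sup>2 + 1) integrable_on {0..1}"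
    using g unfolding sq_int01_def by (intro integrable_add integrable_const_ivl) simp
  show "norm (g t) \<le> (cmod (g t))\<^sup>2 + 1" if "t \<in> {0..1}" for t
    using sum_squares_bound[of "cmod (g t)" 1] norm_ge_zero[of "g t"]
    unfolding power2_eq_square by linarith
qed auto

lemma sq_int01_potential:
  assumes q: "q measurable_on {0..1}" "(\<lambda>t. (q t)\<^sup>2) integrable_on {0..1}"
  shows "sq_int01 (potential q \<mu>)"
proof -
  have "sq_int01 (\<lambda>t. complex_of_real (q t))"
    using q by (auto simp: measurable_on_iff_borel_measurable intro!: sq_int01I[OF _ q(2)])
  moreover have "sq_int01 (\<lambda>_. - \<mu>)" by (intro sq_int01_continuous continuous_intros)
  ultimately have "sq_int01 (\<lambda>t. complex_of_real (q t) + - \<mu>)" by (rule sq_int01_add)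
  then show ?thesis by simp
qed

lemma summable_on_Times_finite_iff:
  fixes F :: "'a \<Rightarrow> 'b \<Rightarrow> 'c::banach"
  assumes "finite J"
  shows "(\<lambda>(x, j). F x j) summable_on (A \<times> J) \<longleftrightarrow> (\<forall>j\<in>J. (\<lambda>x. F x j) summable_on A)"
proof -
  have slice: "(\<lambda>(x, j). F x j) summable_on ((\<lambda>x. (x, j)) ` A) \<longleftrightarrow> (\<lambda>x. F x j) summable_on A" for j
    by (subst summable_on_reindex) (auto simp: inj_on_def o_def)
  have slices: "A \<times> J = (\<Union>j\<in>J. (\<lambda>x. (x, j)) ` A)" by auto
  show ?thesis
  proof (intro iffI ballI)
    fix j assume "j \<in> J" "(\<lambda>(x, j). F x j) summable_on (A \<times> J)"
    from this(2) have "(\<lambda>(x, j). F x j) summable_on ((\<lambda>x. (x, j)) ` A)"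
      by (rule summable_on_subset_banach) (use \<open>j \<in> J\<close> in auto)
    then show "(\<lambda>x. F x j) summable_on A" by (simp add: slice)
  next
    assume "\<forall>j\<in>J. (\<lambda>x. F x j) summable_on A"
    then show "(\<lambda>(x, j). F x j) summable_on (A \<times> J)"
      unfolding slices by (intro summable_on_finite_union_disjoint assms) (auto simp: slice)
  qed
qed

lemma l2_graph_iff:
  "l2_graph g \<longleftrightarrow> (\<forall>j\<in>{1..6}. (\<forall>n. sq_int01 (g n j)) \<and>
     (\<lambda>n. integral {0..1} (\<lambda>t. (cmod (g n j t))\<^sup>2)) summable_on UNIV)"
  unfolding l2_graph_def summable_on_Times_finite_iff[OF finite_atLeastAtMost] by blast

lemma integral_cmod_power2_multiple:
  assumes "\<And>t. t \<in> {a..b} \<Longrightarrow> g t = c * u t"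
  shows "integral {a..b} (\<lambda>t. (cmod (g t))\<^sup>2) = (cmod c)\<^sup>2 * integral {a..b} (\<lambda>t. (cmod (u t))\<^sup>2)"
proof -
  have "integral {a..b} (\<lambda>t. (cmod (g t))\<^sup>2) = integral {a..b} (\<lambda>t. (cmod c)\<^sup>2 * (cmod (u t))\<^sup>2)"
    by (rule integral_cong) (simp add: assms norm_mult power_mult_distrib)
  then show ?thesis by simp
qed

lemma l2_graph_multiples:
  assumes u: "sq_int01 u" and A: "l2_amplitudes A"
    and g: "\<And>n j t. j \<in> {1..6} \<Longrightarrow> t \<in> {0..1} \<Longrightarrow> g n j t = A n j * u t"
  shows "l2_graph g"
  unfolding l2_graph_iff
proof (intro ballI conjI allI)
  fix n and j :: nat assume j: "j \<in> {1..6}"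
  have "sq_int01 (\<lambda>t. u t * A n j)" by (intro sq_int01_mult_continuous u continuous_intros)
  then show "sq_int01 (g n j)" by (rule sq_int01_cong) (simp add: g[OF j] mult.commute)
next
  fix j :: nat assume j: "j \<in> {1..6}"
  have "integral {0..1} (\<lambda>t. (cmod (g n j t))\<^sup>2)
      = (cmod (A n j))\<^sup>2 * integral {0..1} (\<lambda>t. (cmod (u t))\<^sup>2)" for n
    by (rule integral_cmod_power2_multiple) (rule g[OF j])
  then show "(\<lambda>n. integral {0..1} (\<lambda>t. (cmod (g n j t))\<^sup>2)) summable_on UNIV"
    using A j by (auto simp: l2_amplitudes_def l2_seq_def intro: summable_on_cmult_left)
qed

section \<open>The normalized Dirichlet eigenfunction\<close>

lemma has_d2_iff_primitive_on:
  "has_d2 y y2 \<longleftrightarrow> (\<exists>y1. primitive_on 0 1 y1 y \<and> primitive_on 0 1 y2 y1)"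
  unfolding has_d2_def primitive_on_def[of 0 1 y2, symmetric]
  using primitive_on_iff_has_vector_derivative primitive_on_continuous by blast

lemma sl_sol_iff_sturm_liouville_on:
  "sl_sol q \<mu> y \<longleftrightarrow> (\<exists>y'. sturm_liouville_on 0 1 (potential q \<mu>) y y')"
  by (simp add: sl_sol_def has_d2_iff_primitive_on sturm_liouville_on_def)

lemma sturm_liouville_on_d01:
  assumes "sturm_liouville_on 0 1 V y y'" "t \<in> {0..1}"
  shows "d01 y t = y' t"
  unfolding d01_def
  using assms by (intro vector_derivative_within_closed_interval
      sturm_liouville_on_has_vector_derivative) auto

locale dirichlet_eigenfunction =
  fixes q :: "real \<Rightarrow> real" and \<mu> :: complex and w w' :: "real \<Rightarrow> complex"
  assumes q_measurable: "q measurable_on {0..1}"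
    and q_square_integrable: "(\<lambda>t. (q t)\<^sup>2) integrable_on {0..1}"
    and w_solution: "sturm_liouville_on 0 1 (potential q \<mu>) w w'"
    and w_0: "w 0 = 0" and w'_0: "w' 0 = 1" and w_1: "w 1 = 0"
begin

lemma potential_sq_int01: "sq_int01 (potential q \<nu>)"
  by (rule sq_int01_potential[OF q_measurable q_square_integrable])

lemmas potential_integrable = sq_int01_imp_absolutely_integrable[OF potential_sq_int01]

lemma w_nontrivial: "\<exists>t\<in>{0..1}. w t \<noteq> 0"
proof (rule ccontr)
  assume "\<not> (\<exists>t\<in>{0..1}. w t \<noteq> 0)"
  then have "sturm_liouville_on 0 1 (potential q \<mu>) w (\<lambda>_. 0)"
    by (auto simp: sturm_liouville_on_def primitive_on_def intro!: has_integral_is_0)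
  from sturm_liouville_on_d01[OF this, of 0] show False
    using sturm_liouville_on_d01[OF w_solution, of 0] w'_0 by simp
qed

lemma w_norm_nonzero: "integral {0..1} (\<lambda>t. (cmod (w t))\<^sup>2) \<noteq> 0"
proof -
  have "continuous_on {0..1} (\<lambda>t. (cmod (w t))\<^sup>2)"
    by (intro continuous_intros sturm_liouville_on_continuous[OF w_solution])
  from integral_eq_0_iff[OF this] w_nontrivial show ?thesis by auto
qed

lemma w'_1_nonzero: "w' 1 \<noteq> 0"
  using sturm_liouville_on_unique(2)[OF w_solution potential_integrable, of 1 0] w_1 w'_0 by auto

lemma normalized_solution_unique:
  assumes "sturm_liouville_on 0 1 (potential q \<mu>) y y'" "y 0 = 0" "y' 0 = 1"
  shows "y' 1 = w' 1"
  using sturm_liouville_on_proportional(2)[OF potential_integrable w_solution w_0 w'_0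
      assms(1,2), of 1] assms(3) by simp

lemma w'_1_real: "w' 1 \<in> \<real>"
proof -
  have "\<mu> \<in> \<real>"
    using dirichlet_eigenvalue_real[OF _ potential_integrable w_solution w_0 w_1 w_nontrivial]
    by simp
  then have "sturm_liouville_on 0 1 (potential q \<mu>) (\<lambda>t. cnj (w t)) (\<lambda>t. cnj (w' t))"
    using sturm_liouville_on_cnj[OF w_solution] by (simp add: Reals_cnj_iff)
  from normalized_solution_unique[OF this] show ?thesis by (simp add: w_0 w'_0 Reals_cnj_iff)
qed

lemma phi_d1_eq: "phi_d1 q \<mu> = w' 1"
  unfolding phi_d1_def
proof (rule the_equality)
  show "\<exists>y. sl_sol q \<mu> y \<and> y 0 = 0 \<and> d01 y 0 = 1 \<and> d01 y 1 = w' 1"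
    using w_solution w_0 w'_0 sturm_liouville_on_d01[OF w_solution]
    by (intro exI[of _ w]) (auto simp: sl_sol_iff_sturm_liouville_on)
next
  fix c assume "\<exists>y. sl_sol q \<mu> y \<and> y 0 = 0 \<and> d01 y 0 = 1 \<and> d01 y 1 = c"
  then obtain y y' where y: "sturm_liouville_on 0 1 (potential q \<mu>) y y'"
      "y 0 = 0" "d01 y 0 = 1" "d01 y 1 = c"
    unfolding sl_sol_iff_sturm_liouville_on by blast
  then show "c = w' 1"
    using normalized_solution_unique[OF y(1)] sturm_liouville_on_d01[OF y(1)] by simp
qed

lemma solution_endpoints:
  assumes "sl_sol q \<mu> g"
  shows "g 1 * w' 1 = g 0"
  using assms wronskian_constant[OF _ w_solution potential_integrable, of g _ 1] w_0 w'_0 w_1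
  by (auto simp: sl_sol_iff_sturm_liouville_on)

lemma l2_seq_solution_at_0:
  assumes g: "\<And>n. sl_sol q \<mu> (g n)"
    and l2: "(\<lambda>n. integral {0..1} (\<lambda>t. (cmod (g n t))\<^sup>2)) summable_on UNIV"
  shows "l2_seq (\<lambda>n. g n 0)"
proof -
  obtain C where C: "\<And>y y'. sturm_liouville_on 0 1 (potential q \<mu>) y y' \<Longrightarrow>
      (cmod (of_real (1 - 0) * (y 0 * w' 0)))\<^sup>2 \<le> C * integral {0..1} (\<lambda>t. (cmod (y t))\<^sup>2)"
    using dirichlet_endpoint_le_L2_norm[OF _ potential_integrable w_solution w_0 w_1] by auto
  show ?thesis
    unfolding l2_seq_def
  proof (rule summable_on_comparison_test)
    show "(\<lambda>n. C * integral {0..1} (\<lambda>t. (cmod (g n t))\<^sup>2)) summable_on UNIV"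
      using l2 by (rule summable_on_cmult_right)
    show "(cmod (g n 0))\<^sup>2 \<le> C * integral {0..1} (\<lambda>t. (cmod (g n t))\<^sup>2)" for n
      using g[of n] C[of "g n"] w'_0 by (auto simp: sl_sol_iff_sturm_liouville_on)
  qed auto
qed

end

lemma dir_spec_imp_dirichlet_eigenfunction:
  assumes q: "q measurable_on {0..1}" "(\<lambda>t. (q t)\<^sup>2) integrable_on {0..1}" and "\<mu> \<in> dir_spec q"
  obtains w w' where "dirichlet_eigenfunction q \<mu> w w'"
proof -
  obtain y y' where y: "sturm_liouville_on 0 1 (potential q \<mu>) y y'"
      "y 0 = 0" "y 1 = 0" "\<exists>t\<in>{0..1}. y t \<noteq> 0"
    using assms(3) unfolding dir_spec_def sl_sol_iff_sturm_liouville_on by blast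
  have "y' 0 \<noteq> 0"
    using sturm_liouville_on_unique(1)[OF y(1), of 0]
      sq_int01_imp_absolutely_integrable[OF sq_int01_potential[OF q]] y by auto
  then have "dirichlet_eigenfunction q \<mu> (\<lambda>t. inverse (y' 0) * y t) (\<lambda>t. inverse (y' 0) * y' t)"
    using q y by unfold_locales (auto intro: sturm_liouville_on_scale)
  then show ?thesis by (rule that)
qed

section \<open>Eigenfunctions on the graph\<close>

definition slope :: "(int \<Rightarrow> nat \<Rightarrow> real \<Rightarrow> complex) \<Rightarrow> int \<Rightarrow> nat \<Rightarrow> complex" where
  "slope f n j = d01 (f n j) 0"

lemma eig_spaceD:
  assumes "f \<in> eig_space q a1 a2 N k \<mu>"
  shows "j \<in> {1..6} \<Longrightarrow> sl_sol q \<mu> (f n j)" "l2_graph f" "BC a1 a2 N k f"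
proof -
  obtain f2 where f2: "dom_H a1 a2 N k f f2" and eq: "\<And>n j. j \<in> {1..6} \<Longrightarrow>
      negligible {t\<in>{0..1}. - f2 n j t + complex_of_real (q t) * f n j t \<noteq> \<mu> * f n j t}"
    using assms unfolding eig_space_def by blast
  then show "l2_graph f" "BC a1 a2 N k f" by (simp_all add: dom_H_def)
  show "sl_sol q \<mu> (f n j)" if j: "j \<in> {1..6}"
  proof -
    obtain y1 where y1: "primitive_on 0 1 y1 (f n j)" "primitive_on 0 1 (f2 n j) y1"
      using f2 j unfolding dom_H_def has_d2_iff_primitive_on by blast
    have "primitive_on 0 1 (\<lambda>t. potential q \<mu> t * f n j t) y1"
      unfolding primitive_on_def
    proof
      fix t :: real assume t: "t \<in> {0..1}"
      show "((\<lambda>t. potential q \<mu> t * f n j t) has_integral (y1 t - y1 0)) {0..t}"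
      proof (rule has_integral_spike[OF eq[OF j, of n]])
        show "(f2 n j has_integral (y1 t - y1 0)) {0..t}"
          using y1(2) t by (simp add: primitive_on_def)
      qed (use t in \<open>auto simp: algebra_simps\<close>)
    qed
    with y1(1) show ?thesis unfolding sl_sol_def has_d2_iff_primitive_on by blast
  qed
qed

lemma eig_spaceI:
  assumes "\<And>n j. j \<in> {1..6} \<Longrightarrow> sl_sol q \<mu> (f n j)" "l2_graph f" "BC a1 a2 N k f"
    and "l2_graph (\<lambda>n j t. potential q \<mu> t * f n j t)"
  shows "f \<in> eig_space q a1 a2 N k \<mu>"
proof -
  have "dom_H a1 a2 N k f (\<lambda>n j t. potential q \<mu> t * f n j t)"
    using assms by (simp add: dom_H_def sl_sol_def)
  moreover have "negligible {t\<in>{0..1}. - (potential q \<mu> t * f n j t)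
      + complex_of_real (q t) * f n j t \<noteq> \<mu> * f n j t}" for n j
    by (simp add: algebra_simps)
  ultimately show ?thesis unfolding eig_space_def by blast
qed

lemma BC_endpoints:
  assumes "BC a1 a2 N k f"
  shows "cis a1 * f n 1 1 = f n 2 0" "f n 2 0 = f n 5 0"
    "cis a2 * f n 2 1 = f n 3 0" "f n 3 0 = f n 6 0"
    "cis a1 * f n 3 1 = f n 4 0" "f n 4 0 = cis a1 * f (n - 1) 6 1"
    "cis a2 * sroot N ^ k * f n 4 1 = f n 1 0" "f n 1 0 = cis (- a1) * f (n - 1) 5 1"
  using assms by (auto simp: BC_def)

locale dirichlet_graph = dirichlet_eigenfunction +
  fixes a1 a2 :: real and N k :: nat

sublocale dirichlet_graph \<subseteq> unimodular_kirchhoff "cis a1" "cis a2" "sroot N ^ k" "w' 1"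
  by unfold_locales (simp_all add: sroot_def norm_power w'_1_real)

context dirichlet_graph
begin

abbreviation eigenspace :: "(int \<Rightarrow> nat \<Rightarrow> real \<Rightarrow> complex) set" where
  "eigenspace \<equiv> eig_space q a1 a2 N k \<mu>"

definition edge_multiple :: "(int \<Rightarrow> nat \<Rightarrow> complex) \<Rightarrow> int \<Rightarrow> nat \<Rightarrow> real \<Rightarrow> complex" where
  "edge_multiple A n j t = A n j * w t"

lemma eigenspace_vertex_6:
  assumes f: "f \<in> eigenspace"
  shows "f n 6 0 = 0"
proof (rule l2_seq_periodic_imp_zero)
  note bc = BC_endpoints[OF eig_spaceD(3)[OF f]]
  show "f n 6 0 = f (n - 1) 6 0" for n
  proof -
    have "f n 3 1 = f (n - 1) 6 1" using bc(5,6)[of n] by simp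
    then show ?thesis
      using solution_endpoints[OF eig_spaceD(1)[OF f], of 3 n]
        solution_endpoints[OF eig_spaceD(1)[OF f], of 6 "n - 1"] bc(4)[of n] by simp
  qed
  show "l2_seq (\<lambda>n. f n 6 0)"
    using eig_spaceD(1,2)[OF f] by (intro l2_seq_solution_at_0) (auto simp: l2_graph_iff)
qed

lemma eigenspace_vertices:
  assumes f: "f \<in> eigenspace" and j: "j \<in> {1..6}"
  shows "f n j 0 = 0" "f n j 1 = 0"
proof -
  note bc = BC_endpoints[OF eig_spaceD(3)[OF f], of n]
  have right: "f n j 1 * w' 1 = f n j 0" if "j \<in> {1..6}" for j
    by (rule solution_endpoints[OF eig_spaceD(1)[OF f that]])
  have "f n 3 0 = 0" using bc(4) eigenspace_vertex_6[OF f] by simp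
  then have "f n 2 1 = 0" "f n 3 1 = 0" using bc(3) right[of 3] w'_1_nonzero by auto
  then have "f n 2 0 = 0" "f n 4 0 = 0" using bc(5) right[of 2] by auto
  then have "f n 1 1 = 0" "f n 5 0 = 0" using bc(1,2) by auto
  then have "f n 1 0 = 0" using right[of 1] by simp
  have "\<forall>j\<in>{1..6}. f n j 0 = 0"
    unfolding atLeastAtMost_1_6 ball_simps
    using \<open>f n 1 0 = 0\<close> \<open>f n 2 0 = 0\<close> \<open>f n 3 0 = 0\<close> \<open>f n 4 0 = 0\<close> \<open>f n 5 0 = 0\<close>
      eigenspace_vertex_6[OF f] by blast
  with j show "f n j 0 = 0" by blast
  then show "f n j 1 = 0" using right[OF j] w'_1_nonzero by simp
qed

lemma eigenspace_edges:
  assumes f: "f \<in> eigenspace" and j: "j \<in> {1..6}"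
  shows "\<And>t. t \<in> {0..1} \<Longrightarrow> f n j t = slope f n j * w t" "d01 (f n j) 1 = slope f n j * w' 1"
proof -
  obtain y' where y': "sturm_liouville_on 0 1 (potential q \<mu>) (f n j) y'"
    using eig_spaceD(1)[OF f j] unfolding sl_sol_iff_sturm_liouville_on by blast
  note proportional =
    sturm_liouville_on_proportional[OF potential_integrable w_solution w_0 w'_0 y'
      eigenspace_vertices(1)[OF f j]]
  have slope: "slope f n j = y' 0" by (simp add: slope_def sturm_liouville_on_d01[OF y'])
  show "f n j t = slope f n j * w t" if "t \<in> {0..1}" for t
    unfolding slope by (rule proportional(1)[OF that])
  show "d01 (f n j) 1 = slope f n j * w' 1"
    using proportional(2)[of 1] by (simp add: slope sturm_liouville_on_d01[OF y'])
qed

lemma l2_amplitudes_slope: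
  assumes f: "f \<in> eigenspace"
  shows "l2_amplitudes (slope f)"
  unfolding l2_amplitudes_def l2_seq_def
proof
  fix j :: nat assume j: "j \<in> {1..6}"
  have "integral {0..1} (\<lambda>t. (cmod (f n j t))\<^sup>2)
      = (cmod (slope f n j))\<^sup>2 * integral {0..1} (\<lambda>t. (cmod (w t))\<^sup>2)" for n
    by (rule integral_cmod_power2_multiple) (rule eigenspace_edges(1)[OF f j])
  moreover have "(\<lambda>n. integral {0..1} (\<lambda>t. (cmod (f n j t))\<^sup>2)) summable_on UNIV"
    using eig_spaceD(2)[OF f] j by (simp add: l2_graph_iff)
  ultimately show "(\<lambda>n. (cmod (slope f n j))\<^sup>2) summable_on UNIV"
    using w_norm_nonzero by (simp add: summable_on_cmult_left')
qed

lemma kirchhoff_slope: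
  assumes f: "f \<in> eigenspace"
  shows "kirchhoff (slope f)"
proof -
  have right: "d01 (f n j) 1 = slope f n j * w' 1" if "j \<in> {1..6}" for n j
    by (rule eigenspace_edges(2)[OF f that])
  show ?thesis
    using eig_spaceD(3)[OF f] unfolding BC_def kirchhoff_def
    by (simp add: right slope_def[symmetric] algebra_simps)
qed

lemma edge_multiple_solution:
  assumes "\<And>t. t \<in> {0..1} \<Longrightarrow> y t = c * w t"
  shows "sl_sol q \<mu> y" "d01 y 0 = c" "d01 y 1 = c * w' 1"
proof -
  have y: "sturm_liouville_on 0 1 (potential q \<mu>) y (\<lambda>t. c * w' t)"
    by (rule sturm_liouville_on_cong[OF sturm_liouville_on_scale[OF w_solution]]) (simp add: assms)
  then show "sl_sol q \<mu> y" unfolding sl_sol_iff_sturm_liouville_on by blast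
  show "d01 y 0 = c" "d01 y 1 = c * w' 1"
    using sturm_liouville_on_d01[OF y] w'_0 by simp_all
qed

lemma slope_edge_multiple:
  assumes "graph_eq f (edge_multiple A)" "j \<in> {1..6}"
  shows "slope f n j = A n j"
  using assms unfolding slope_def
  by (intro edge_multiple_solution(2)) (simp add: graph_eq_def edge_multiple_def)

lemma edge_multiple_in_eigenspace:
  assumes A: "l2_amplitudes A" "kirchhoff A" and "graph_eq f (edge_multiple A)"
  shows "f \<in> eigenspace"
proof (rule eig_spaceI)
  have f: "f n j t = A n j * w t" if "j \<in> {1..6}" "t \<in> {0..1}" for n j t
    using assms(3) that by (simp add: graph_eq_def edge_multiple_def)
  have w_cont: "continuous_on {0..1} w" by (rule sturm_liouville_on_continuous[OF w_solution])
  show "sl_sol q \<mu> (f n j)" if "j \<in> {1..6}" for n j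
    by (rule edge_multiple_solution(1)[OF f[OF that]])
  show "l2_graph f" by (rule l2_graph_multiples[OF sq_int01_continuous[OF w_cont] A(1) f])
  show "l2_graph (\<lambda>n j t. potential q \<mu> t * f n j t)"
    by (rule l2_graph_multiples[OF sq_int01_mult_continuous[OF potential_sq_int01[of \<mu>] w_cont]
          A(1)]) (simp add: f)
  have "d01 (f n j) 0 = A n j" "d01 (f n j) 1 = A n j * w' 1" if "j \<in> {1..6}" for n j
    using edge_multiple_solution(2,3)[OF f[OF that]] by auto
  then show "BC a1 a2 N k f"
    using A(2) unfolding BC_def kirchhoff_def by (simp add: f w_0 w_1 algebra_simps)
qed

lemma cis_double_sum: "cis (2 * (a1 + a2)) = (cis a1 * cis a2)\<^sup>2"
  by (simp add: cis_mult Complex.DeMoivre)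

lemma kappa1_eq: "kappa1 a1 a2 N k (w' 1) = \<kappa>\<^sub>1"
  by (simp only: kappa1_def \<kappa>\<^sub>1_def monodromy_def cis_double_sum)

lemma kappa2_eq: "kappa2 a1 a2 N k (w' 1) = \<kappa>\<^sub>2"
  by (simp only: kappa2_def \<kappa>\<^sub>2_def monodromy_def cis_double_sum)

lemma degenerate_iff: "degenerate \<longleftrightarrow> s_k a1 a2 N k = 0 \<and> (w' 1)\<^sup>2 = 1"
proof -
  define \<theta> where "\<theta> = pi * real k / real N + (a1 + a2)"
  have "real k * (2 * pi / real N) + 2 * (a1 + a2) = 2 * \<theta>"
    by (simp add: \<theta>_def algebra_simps)
  then have "sroot N ^ k * cis (2 * (a1 + a2)) = cis (2 * \<theta>)"
    unfolding sroot_def Complex.DeMoivre cis_mult by (rule arg_cong)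
  then have "monodromy = cis (2 * \<theta>)" by (simp only: monodromy_def cis_double_sum)
  moreover have "cis (2 * \<theta>) = 1 \<longleftrightarrow> sin \<theta> = 0"
    using cos_double_sin[of \<theta>] sin_double[of \<theta>] by (auto simp: complex_eq_iff)
  ultimately show ?thesis by (simp add: degenerate_def s_k_def \<theta>_def)
qed

lemma hatf_eq: "hatf a1 a2 N k (w' 1) f = coords (slope f)"
proof -
  have "cis (a1 + a2 + a1) = (cis a1)\<^sup>2 * cis a2" "cis (a1 + a2) = cis a1 * cis a2"
    by (simp_all add: cis_mult power2_eq_square add_ac)
  then show ?thesis
    by (intro ext) (simp only: hatf_def coords_def degenerate_iff kappa1_eq kappa2_eq slope_def)
qed

definition basic_eigenfunction :: "nat \<Rightarrow> int \<Rightarrow> nat \<Rightarrow> real \<Rightarrow> complex" where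
  "basic_eigenfunction \<nu> = edge_multiple (superposition basis (unit_coords 0 \<nu>))"

lemma shift_basic_eigenfunction:
  assumes "\<nu> \<in> {1, 2}"
  shows "shift n (basic_eigenfunction \<nu>) = edge_multiple (superposition basis (unit_coords n \<nu>))"
  using assms
  by (intro ext)
    (auto simp: shift_def basic_eigenfunction_def edge_multiple_def superposition_unit_coords)

lemma basic_eigenfunction_support:
  assumes "\<nu> \<in> {1, 2}" "n \<notin> {0, 1}"
  shows "basic_eigenfunction \<nu> n j t = 0"
  using assms by (simp add: basic_eigenfunction_def edge_multiple_def superposition_unit_coords)

lemma edge_multiple_superposition_in_eigenspace:
  assumes "l2_seq (\<lambda>n. h n 1)" "l2_seq (\<lambda>n. h n 2)"
  shows "edge_multiple (superposition basis h) \<in> eigenspace"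
  by (rule edge_multiple_in_eigenspace[OF l2_amplitudes_superposition[OF assms]
        kirchhoff_superposition])
    (simp add: graph_eq_def)

lemma shift_basic_eigenfunction_in_eigenspace:
  assumes "\<nu> \<in> {1, 2}"
  shows "shift n (basic_eigenfunction \<nu>) \<in> eigenspace"
  unfolding shift_basic_eigenfunction[OF assms]
  by (intro edge_multiple_superposition_in_eigenspace l2_seq_unit_coords)

lemma basic_eigenfunction_in_eigenspace:
  assumes "\<nu> \<in> {1, 2}"
  shows "basic_eigenfunction \<nu> \<in> eigenspace"
  using shift_basic_eigenfunction_in_eigenspace[OF assms, of 0] by (simp add: shift_def)

lemma coords_slope_superposition:
  assumes "\<nu> \<in> {1, 2}"
  shows "coords (slope (edge_multiple (superposition basis h))) n \<nu> = h n \<nu>"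
proof -
  have "coords (slope (edge_multiple (superposition basis h))) n \<nu>
      = coords (superposition basis h) n \<nu>"
    by (rule coords_cong, rule slope_edge_multiple) (simp_all add: graph_eq_def)
  then show ?thesis using coords_superposition[OF assms] by simp
qed

lemma eigenspace_eq_superposition:
  assumes f: "f \<in> eigenspace" and jt: "j \<in> {1..6}" "t \<in> {0..1}"
  shows "f n j t = superposition basis (coords (slope f)) n j * w t"
  unfolding superposition_coords[OF kirchhoff_slope[OF f] l2_amplitudes_slope[OF f] jt(1)]
  by (rule eigenspace_edges(1)[OF f jt])

lemma eigenspace_expansion:
  assumes f: "f \<in> eigenspace" and jt: "j \<in> {1..6}" "t \<in> {0..1}"
  shows "((\<lambda>(n, \<nu>). coords (slope f) n \<nu> * shift n (basic_eigenfunction \<nu>) m j t) has_sum f m j t)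
    (UNIV \<times> {1, 2})"
proof -
  have "((\<lambda>(n, \<nu>). coords (slope f) n \<nu> * superposition basis (unit_coords n \<nu>) m j * w t)
      has_sum f m j t) (UNIV \<times> {1, 2})"
    unfolding eigenspace_eq_superposition[OF f jt]
    using has_sum_cmult_left[OF has_sum_superposition, of "coords (slope f)" basis m j "w t"]
    by (simp add: case_prod_unfold)
  then show ?thesis
    by (rule has_sum_cong[THEN iffD1, rotated])
      (auto simp: shift_basic_eigenfunction edge_multiple_def)
qed

lemma eigenspace_add_mult:
  fixes c :: complex
  assumes f: "f \<in> eigenspace" and g: "g \<in> eigenspace"
  defines "F \<equiv> \<lambda>n j t. f n j t + c * g n j t"
  shows "F \<in> eigenspace" "coords (slope F) n \<nu> = coords (slope f) n \<nu> + c * coords (slope g) n \<nu>"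
proof -
  define A where "A = (\<lambda>n j. slope f n j + c * slope g n j)"
  have F: "graph_eq F (edge_multiple A)"
    using eigenspace_edges(1)[OF f] eigenspace_edges(1)[OF g]
    by (simp add: graph_eq_def F_def A_def edge_multiple_def algebra_simps)
  have "l2_amplitudes A"
    using l2_amplitudes_slope[OF f] l2_amplitudes_slope[OF g]
    by (auto simp: l2_amplitudes_def A_def intro!: l2_seq_add l2_seq_cmult)
  moreover have "kirchhoff A"
    unfolding A_def by (intro kirchhoff_add_mult kirchhoff_slope f g)
  ultimately show "F \<in> eigenspace" using F by (rule edge_multiple_in_eigenspace)
  have "coords (slope F) n \<nu> = coords A n \<nu>"
    by (rule coords_cong, rule slope_edge_multiple[OF F])
  then show "coords (slope F) n \<nu> = coords (slope f) n \<nu> + c * coords (slope g) n \<nu>"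
    by (simp add: A_def coords_add_mult)
qed

lemma eigenspace_coords_inject:
  assumes f: "f \<in> eigenspace" and g: "g \<in> eigenspace"
    and eq: "\<And>n \<nu>. \<nu> \<in> {1, 2} \<Longrightarrow> coords (slope f) n \<nu> = coords (slope g) n \<nu>"
  shows "graph_eq f g"
  using eigenspace_eq_superposition[OF f] eigenspace_eq_superposition[OF g] eq
  by (simp add: graph_eq_def superposition_def)

lemma eigenspace_coords_surject:
  assumes "l2_seq (\<lambda>n. c n 1)" "l2_seq (\<lambda>n. c n 2)"
  shows "\<exists>f\<in>eigenspace. \<forall>n. \<forall>\<nu>\<in>{1, 2}. coords (slope f) n \<nu> = c n \<nu>"
  using edge_multiple_superposition_in_eigenspace[OF assms] coords_slope_superposition by blast

end

theorem theorem2p2: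
  fixes q :: "real \<Rightarrow> real" and N k :: nat and a1 a2 :: real and \<mu> :: complex
  assumes q_L2: "q measurable_on {0..1}" "(\<lambda>t. (q t)\<^sup>2) integrable_on {0..1}"
    and N: "N \<ge> 1" and k: "k < N"
    and mu: "\<mu> \<in> dir_spec q"
  defines "\<phi> \<equiv> phi_d1 q \<mu>"
    and "H \<equiv> eig_space q a1 a2 N k \<mu>"
    and "hat \<equiv> hatf a1 a2 N k (phi_d1 q \<mu>)"
  shows
    "(\<forall>f\<in>H. \<forall>n. \<forall>j\<in>{1..6}. f n j 0 = 0 \<and> f n j 1 = 0)
     \<and> (\<not> (s_k a1 a2 N k = 0 \<and> \<phi>\<^sup>2 = 1) \<longrightarrow>
          kappa1 a1 a2 N k \<phi> \<noteq> 0 \<and> kappa2 a1 a2 N k \<phi> \<noteq> 0)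
     \<and> (\<exists>\<psi> :: nat \<Rightarrow> int \<Rightarrow> nat \<Rightarrow> real \<Rightarrow> complex.
          (\<forall>\<nu>\<in>{1,2}. \<psi> \<nu> \<in> H)
        \<and> (\<forall>\<nu>\<in>{1,2}. \<forall>n. \<forall>j\<in>{1..6}. \<forall>t\<in>{0..1}. n \<notin> {0,1} \<longrightarrow> \<psi> \<nu> n j t = 0)
        \<and> (\<forall>\<nu>\<in>{1,2}. \<forall>n. shift n (\<psi> \<nu>) \<in> H)
        \<and> (\<forall>f\<in>H. l2_seq (\<lambda>n. hat f n 1) \<and> l2_seq (\<lambda>n. hat f n 2) \<and>
             (\<forall>m. \<forall>j\<in>{1..6}. \<forall>t\<in>{0..1}.
                ((\<lambda>(n,\<nu>). hat f n \<nu> * shift n (\<psi> \<nu>) m j t) has_sum f m j t) (UNIV \<times> {1,2}))))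
     \<and> (\<forall>f\<in>H. \<forall>g\<in>H. \<forall>c. (\<lambda>n j t. f n j t + c * g n j t) \<in> H \<and>
          (\<forall>n. \<forall>\<nu>\<in>{1,2}. hat (\<lambda>n j t. f n j t + c * g n j t) n \<nu> = hat f n \<nu> + c * hat g n \<nu>))
     \<and> (\<forall>f\<in>H. \<forall>g\<in>H. (\<forall>n. \<forall>\<nu>\<in>{1,2}. hat f n \<nu> = hat g n \<nu>) \<longrightarrow> graph_eq f g)
     \<and> (\<forall>c :: int \<Rightarrow> nat \<Rightarrow> complex. l2_seq (\<lambda>n. c n 1) \<and> l2_seq (\<lambda>n. c n 2) \<longrightarrow>
          (\<exists>f\<in>H. \<forall>n. \<forall>\<nu>\<in>{1,2}. hat f n \<nu> = c n \<nu>))"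
proof -
  obtain w w' where "dirichlet_eigenfunction q \<mu> w w'"
    by (rule dir_spec_imp_dirichlet_eigenfunction[OF q_L2 mu])
  then interpret dirichlet_graph q \<mu> w w' a1 a2 N k by (simp add: dirichlet_graph_def)
  have \<phi>: "\<phi> = w' 1" unfolding \<phi>_def by (rule phi_d1_eq)
  have hat: "hat f = coords (slope f)" for f by (simp only: hat_def phi_d1_eq hatf_eq)
  show ?thesis
    unfolding H_def hat \<phi>
  proof (intro conjI exI[of _ basic_eigenfunction] ballI allI impI)
    assume "\<not> (s_k a1 a2 N k = 0 \<and> (w' 1)\<^sup>2 = 1)"
    then show "kappa1 a1 a2 N k (w' 1) \<noteq> 0" "kappa2 a1 a2 N k (w' 1) \<noteq> 0"
      by (simp_all add: kappa1_eq kappa2_eq kappa_nonzero degenerate_iff)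
  next
    fix c :: "int \<Rightarrow> nat \<Rightarrow> complex" assume "l2_seq (\<lambda>n. c n 1) \<and> l2_seq (\<lambda>n. c n 2)"
    then show "\<exists>f\<in>eigenspace. \<forall>n. \<forall>\<nu>\<in>{1, 2}. coords (slope f) n \<nu> = c n \<nu>"
      using eigenspace_coords_surject by blast
  qed (auto simp del: One_nat_def
      intro: eigenspace_vertices basic_eigenfunction_in_eigenspace basic_eigenfunction_support
        shift_basic_eigenfunction_in_eigenspace l2_seq_coords l2_amplitudes_slope
        eigenspace_expansion eigenspace_add_mult eigenspace_coords_inject)
qed

end
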